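(* Let $\rho>0$ and let $t_N=\sqrt{(1+\rho)S\log N/N}$ for $N\ge 1$. Let $\Phi^{(1)}_N,\Phi^{(2)}_N$ be the test matrices computed from the second (never switching) observer. Let the switching input $\alpha_N$ of the closed-loop switched system be given by the rule: (i) choose $\alpha_N=0$ when $\|\Phi^{(1)}_N\|\ge t_N$ or $\|\Phi^{(2)}_N\|\ge t_N$; (ii) switch from $\alpha_{N-1}=0$ to $\alpha_N=1$ when $\alpha_{N-i}=0$ for all $i\in\{1,\dots,\tau\}$ and $\|\Phi^{(1)}_N\|<t_N$ and $\|\Phi^{(2)}_N\|<t_N$ (otherwise $\alpha_N=\alpha_{N-1}$). For $N\ge1$ let $E_N$ be the event $$E_N=\big\{\|\Phi^{(1)}_N\|>t_N\big\}\cup\big\{\|\Phi^{(2)}_N\|>t_N\big\}.$$ If $v_n= 0$ for all $n\ge 0$ (no attack), then $$\mathrm{P}\Big(\limsup_{N\to\infty}E_N\Big)=0.$$ That is, under no attack the switching rule almost surely incorrectly switches the system only a finite number of times.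
   Context: $\|\cdot\|$ is the spectral norm of a matrix (Euclidean norm of a vector); $\preceq$ is the semidefinite order; $\limsup_N E_N=\bigcap_{M}\bigcup_{N\ge M}E_N$. **Switched system.** $x_{n+1}=Ax_n+Bu_n+w_n$, $y_n=C(\alpha_n)x_n+z_n(\alpha_n)+\alpha_nv_n$, with $x_n\in\mathbb R^p$, $u_n\in\mathbb R^q$, $y_n\in\mathbb R^m$, $\alpha_n\in\{0,1\}$, $C(\alpha)=\alpha C_1+(1-\alpha)C_2$, $z_n(\alpha)=\alpha\zeta_n+(1-\alpha)\eta_n$. Here $w_n$ is zero-mean i.i.d. with covariance $\Sigma_w$; $\zeta_n$ and $\eta_n$ are zero-mean i.i.d. with covariances $\Sigma_\zeta\preceq\Sigma_\eta$; the process noise $(w_n)$ is independent of $(\zeta_n,\eta_n)$; almost surely $\|w_n\|\le K_w$ and $\|\zeta_n\|,\|\eta_n\|\le K_z$ for all $n$. $v_n$ is the attack signal. $(A,B)$ is stabilizable, $(A,C_1),(A,C_2)$ are detectable; $K$, $L_1$, $L_2$ are such that $A+BK$, $A+L_1C_1$, $A+L_2C_2$ are Schur stable; $L(\alpha)=\alpha L_1+(1-\alpha)L_2$. The input is $u_n=Kx'_n+e_n$, where the first observer is $x'_{n+1}=(A+BK+L(\alpha_n)C(\alpha_n))x'_n+Be_n-L(\alpha_n)y_n$, and the watermark $e_n\in\mathbb R^q$ is i.i.d. zero-mean with covariance $\Sigma_E=\Sigma_e$, $\|e_n\|\le K_e$ a.s., independent of all noises $(w_n,\zeta_n,\eta_n)$;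 $e_j$ is also defined (i.i.d. with the others) for the finitely many negative indices used below. **Dwell time $\tau$.** Let $\mathcal A(\alpha)=\begin{bmatrix}A+BK&BK\\0&A+L(\alpha)C(\alpha)\end{bmatrix}$, let $P$ solve $\mathcal A(1)P\mathcal A(1)^\top-P=-\mathbb I$, and let $\tau$ be the smallest positive integer with $\mathcal A(0)^\tau P(\mathcal A(0)^\tau)^\top-P\preceq-\mathbb I$ (assumed to exist). **Second observer.** Write $C=C_1$, $L=L_1$, $z_n=\zeta_n$, $\Sigma_z=\Sigma_\zeta$. The second observer never switches and always measures with $C$; when $v\equiv0$, its estimate $\hat x_n$ has error $\delta_n=\hat x_n-x_n$ with $\delta_0=0$ and $\delta_{n+1}=(A+LC)\delta_n-w_n-Lz_n$, and its residual is $d_n:=C\hat x_n-y_n=C\delta_n-z_n$ (here $y_n=Cx_n+z_n$ is the measurement used by the second observer). **Test matrices.** For $0\le k\le n-1$ let $\bar D_{n,k}=-(A+LC)^{n-1-k}$, $\bar L_{n,k}=-(A+LC)^{n-1-k}L$, and $$R_n=C\Big(\sum_{k=0}^{n-1}\bar D_{n,k}\Sigma_w\bar D_{n,k}^\top+\bar L_{n,k}\Sigma_z\bar L_{n,k}^\top\Big)C^\top+\Sigma_z=\mathbb E[d_nd_n^\top].$$ Let $k'=\min\{k\ge0: C(A+BK)^kB\neq0\}$ (assumed to exist). Then $$\Phi^{(1)}_N=\frac1N\sum_{n=0}^{N-1}(d_nd_n^\top-R_n),\qquad \Phi^{(2)}_N=\frac1N\sum_{n=0}^{N-1}d_ne_{n-k'-1}^\top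 .$$ **Constant $S$.** Let $\bar K_n=K_z+\sum_{k=0}^{n-1}(\|C\bar D_{n,k}\|K_w+\|C\bar L_{n,k}\|K_z)$, and $c^{(1)}_N=8\sum_{k=0}^{N-1}\bar K_k^4$; $c^{(2)}_N=\sum_{k=0}^{N-1}\max\{(K_e^2+\mathrm{tr}\,\Sigma_E)\|R_k\|,\ \bar K_k^2(K_e^2+\|\Sigma_E\|)\}$; $c^{(3)}_N=\big\|\sum_{k=0}^{N-1}\big[(K_e^2\mathbb I-\Sigma_e)^2+\mathbb E[(e_ke_k^\top)^2]-\Sigma_e^2\big]\big\|$. $S>0$ is a constant with $\max\{c^{(1)}_N,c^{(2)}_N,c^{(3)}_N\}\le NS$ for all $N\ge1$. *)

theory Defs
  imports "HOL-Probability.Probability"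
begin

definition spec_norm :: "real^'n^'m \<Rightarrow> real" where
  "spec_norm X = onorm (\<lambda>x. X *v x)"

definition outer :: "real^'m \<Rightarrow> real^'n \<Rightarrow> real^'n^'m" where
  "outer x y = (\<chi> i j. x $ i * y $ j)"

text \<open>The operation \<open>^\<close> on \<open>real^'n^'n\<close> is taken entrywise, and so is \<open>\<le>\<close>; neither is the
  operation meant by matrix powers or by the semidefinite order.\<close>

primrec matpow :: "real^'n^'n \<Rightarrow> nat \<Rightarrow> real^'n^'n" where
  "matpow X 0 = mat 1"
| "matpow X (Suc k) = X ** matpow X k"

definition psd :: "real^'n^'n \<Rightarrow> bool" where
  "psd X \<longleftrightarrow> transpose X = X \<and> (\<forall>x. 0 \<le> x \<bullet> (X *v x))"

definition loewner_le :: "real^'n^'n \<Rightarrow> real^'n^'n \<Rightarrow> bool" where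
  "loewner_le X Y \<longleftrightarrow> psd (Y - X)"

definition schur_stable :: "real^'n^'n \<Rightarrow> bool" where
  "schur_stable X \<longleftrightarrow>
     (\<forall>(\<mu>::complex) (v::complex^'n).
        v \<noteq> 0 \<and> (\<chi> i j. complex_of_real (X $ i $ j)) *v v = \<mu> *s v \<longrightarrow> cmod \<mu> < 1)"

definition stabilizable :: "real^'p^'p \<Rightarrow> real^'q^'p \<Rightarrow> bool" where
  "stabilizable A B \<longleftrightarrow> (\<exists>K::real^'p^'q. schur_stable (A + B ** K))"

definition detectable :: "real^'p^'p \<Rightarrow> real^'p^'m \<Rightarrow> bool" where
  "detectable A C \<longleftrightarrow> (\<exists>L::real^'m^'p. schur_stable (A + L ** C))"

definition covariance_matrix :: "'a measure \<Rightarrow> ('a \<Rightarrow> real^'n) \<Rightarrow> real^'n^'n" where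
  "covariance_matrix M X =
     (let \<mu> = (\<integral>\<omega>. X \<omega> \<partial>M) in \<integral>\<omega>. outer (X \<omega> - \<mu>) (X \<omega> - \<mu>) \<partial>M)"

definition (in prob_space) iid :: "('i \<Rightarrow> 'a \<Rightarrow> 'b::topological_space) \<Rightarrow> 'i set \<Rightarrow> bool" where
  "iid X I \<longleftrightarrow> indep_vars (\<lambda>_. borel) X I \<and>
     (\<forall>i\<in>I. \<forall>j\<in>I. distr M borel (X i) = distr M borel (X j))"

text \<open>Independence of whole processes, as independence of the \<open>\<sigma>\<close>-algebras they generate
  (\<^term>\<open>prob_space.indep_var\<close> requires both variables to have the same value type).\<close>

definition generated_events ::
    "'a measure \<Rightarrow> ('i \<Rightarrow> 'a \<Rightarrow> 'b::topological_space) \<Rightarrow> 'i set \<Rightarrow> 'a set set" where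
  "generated_events M X I =
     sigma_sets (space M) (\<Union>i\<in>I. {X i -` U \<inter> space M | U. U \<in> sets borel})"

definition (in prob_space) indep_processes ::
    "('i \<Rightarrow> 'a \<Rightarrow> 'b::topological_space) \<Rightarrow> 'i set \<Rightarrow>
     ('j \<Rightarrow> 'a \<Rightarrow> 'c::topological_space) \<Rightarrow> 'j set \<Rightarrow> bool" where
  "indep_processes X I Y J \<longleftrightarrow> indep_set (generated_events M X I) (generated_events M Y J)"

text \<open>\<open>C(\<alpha>)\<close>, \<open>L(\<alpha>)\<close> and \<open>z(\<alpha>)\<close> are all of this form; mode \<open>1\<close> selects the first argument.\<close>

definition switch :: "real \<Rightarrow> 'v \<Rightarrow> 'v \<Rightarrow> 'v::real_vector" where
  "switch \<alpha> X1 X2 = \<alpha> *\<^sub>R X1 + (1 - \<alpha>) *\<^sub>R X2"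

text \<open>The block matrix \<open>[A + BK, BK; 0, A + L(\<alpha>)C(\<alpha>)]\<close>.\<close>

definition block_matrix ::
    "real^'p^'p \<Rightarrow> real^'q^'p \<Rightarrow> real^'p^'q \<Rightarrow> real^'p^'m \<Rightarrow> real^'p^'m \<Rightarrow>
     real^'m^'p \<Rightarrow> real^'m^'p \<Rightarrow> real \<Rightarrow> real^('p + 'p)^('p + 'p)" where
  "block_matrix A B K C1 C2 L1 L2 \<alpha> = (\<chi> i j.
     (case i of
        Inl i' \<Rightarrow> (case j of Inl j' \<Rightarrow> (A + B ** K) $ i' $ j' | Inr j' \<Rightarrow> (B ** K) $ i' $ j')
      | Inr i' \<Rightarrow> (case j of Inl j' \<Rightarrow> 0
                          | Inr j' \<Rightarrow> (A + switch \<alpha> L1 L2 ** switch \<alpha> C1 C2) $ i' $ j')))"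

definition dwell_condition :: "real^'n^'n \<Rightarrow> real^'n^'n \<Rightarrow> nat \<Rightarrow> bool" where
  "dwell_condition \<A>0 P t \<longleftrightarrow>
     loewner_le (matpow \<A>0 t ** P ** transpose (matpow \<A>0 t) - P) (- mat 1)"

definition is_dwell_time :: "real^'n^'n \<Rightarrow> real^'n^'n \<Rightarrow> nat \<Rightarrow> bool" where
  "is_dwell_time \<A>0 P \<tau> \<longleftrightarrow> 0 < \<tau> \<and> dwell_condition \<A>0 P \<tau> \<and>
     (\<forall>t. 0 < t \<and> t < \<tau> \<longrightarrow> \<not> dwell_condition \<A>0 P t)"

definition is_first_markov_index ::
    "real^'p^'p \<Rightarrow> real^'q^'p \<Rightarrow> real^'p^'q \<Rightarrow> real^'p^'m \<Rightarrow> nat \<Rightarrow> bool" where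
  "is_first_markov_index A B K C k' \<longleftrightarrow>
     C ** matpow (A + B ** K) k' ** B \<noteq> 0 \<and>
     (\<forall>k<k'. C ** matpow (A + B ** K) k ** B = 0)"

text \<open>One sample path of the switching signal; \<open>thr N\<close> says that one of the two tests reaches the
  threshold at time \<open>N\<close>. The signal is indexed by integers so that \<open>\<alpha> (N - i)\<close> makes sense for
  \<open>N < i\<close>; its values at times \<open>\<le> 0\<close> are an arbitrary initial history.\<close>

definition switching_rule :: "nat \<Rightarrow> (nat \<Rightarrow> bool) \<Rightarrow> (int \<Rightarrow> real) \<Rightarrow> bool" where
  "switching_rule \<tau> thr \<alpha> \<longleftrightarrow> (\<forall>N\<ge>1. \<alpha> (int N) =
     (if thr N then 0
      else if \<alpha> (int N - 1) = 0 \<and> (\<forall>i\<in>{1..\<tau>}. \<alpha> (int N - int i) = 0) then 1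
      else \<alpha> (int N - 1)))"

definition Dbar :: "real^'p^'p \<Rightarrow> real^'m^'p \<Rightarrow> real^'p^'m \<Rightarrow> nat \<Rightarrow> nat \<Rightarrow> real^'p^'p" where
  "Dbar A L C n k = - matpow (A + L ** C) (n - 1 - k)"

definition Lbar :: "real^'p^'p \<Rightarrow> real^'m^'p \<Rightarrow> real^'p^'m \<Rightarrow> nat \<Rightarrow> nat \<Rightarrow> real^'m^'p" where
  "Lbar A L C n k = - (matpow (A + L ** C) (n - 1 - k) ** L)"

definition Rmat ::
    "real^'p^'p \<Rightarrow> real^'m^'p \<Rightarrow> real^'p^'m \<Rightarrow> real^'p^'p \<Rightarrow> real^'m^'m \<Rightarrow> nat \<Rightarrow> real^'m^'m" where
  "Rmat A L C \<Sigma>w \<Sigma>z n =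
     C ** (\<Sum>k<n. Dbar A L C n k ** \<Sigma>w ** transpose (Dbar A L C n k)
               + Lbar A L C n k ** \<Sigma>z ** transpose (Lbar A L C n k)) ** transpose C + \<Sigma>z"

definition Phi1 :: "(nat \<Rightarrow> real^'m) \<Rightarrow> (nat \<Rightarrow> real^'m^'m) \<Rightarrow> nat \<Rightarrow> real^'m^'m" where
  "Phi1 d R N = (1 / real N) *\<^sub>R (\<Sum>n<N. outer (d n) (d n) - R n)"

definition Phi2 :: "(nat \<Rightarrow> real^'m) \<Rightarrow> (int \<Rightarrow> real^'q) \<Rightarrow> nat \<Rightarrow> nat \<Rightarrow> real^'q^'m" where
  "Phi2 d e k' N = (1 / real N) *\<^sub>R (\<Sum>n<N. outer (d n) (e (int n - int k' - 1)))"

definition threshold :: "real \<Rightarrow> real \<Rightarrow> nat \<Rightarrow> real" where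
  "threshold \<rho> S N = sqrt ((1 + \<rho>) * S * ln (real N) / real N)"

definition Kbar ::
    "real^'p^'p \<Rightarrow> real^'m^'p \<Rightarrow> real^'p^'m \<Rightarrow> real \<Rightarrow> real \<Rightarrow> nat \<Rightarrow> real" where
  "Kbar A L C Kw Kz n = Kz +
     (\<Sum>k<n. spec_norm (C ** Dbar A L C n k) * Kw + spec_norm (C ** Lbar A L C n k) * Kz)"

definition c1 :: "(nat \<Rightarrow> real) \<Rightarrow> nat \<Rightarrow> real" where
  "c1 Kb N = 8 * (\<Sum>k<N. Kb k ^ 4)"

definition c2 ::
    "(nat \<Rightarrow> real) \<Rightarrow> (nat \<Rightarrow> real^'m^'m) \<Rightarrow> real \<Rightarrow> real^'q^'q \<Rightarrow> nat \<Rightarrow> real" where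
  "c2 Kb R Ke \<Sigma>e N =
     (\<Sum>k<N. max ((Ke\<^sup>2 + trace \<Sigma>e) * spec_norm (R k)) ((Kb k)\<^sup>2 * (Ke\<^sup>2 + spec_norm \<Sigma>e)))"

definition c3 :: "'a measure \<Rightarrow> (int \<Rightarrow> 'a \<Rightarrow> real^'q) \<Rightarrow> real \<Rightarrow> real^'q^'q \<Rightarrow> nat \<Rightarrow> real" where
  "c3 M e Ke \<Sigma>e N = spec_norm (\<Sum>k<N.
     (Ke\<^sup>2 *\<^sub>R mat 1 - \<Sigma>e) ** (Ke\<^sup>2 *\<^sub>R mat 1 - \<Sigma>e)
     + (\<integral>\<omega>. outer (e (int k) \<omega>) (e (int k) \<omega>) ** outer (e (int k) \<omega>) (e (int k) \<omega>) \<partial>M)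
     - \<Sigma>e ** \<Sigma>e)"

end

theory Submission
  imports Defs
begin

text \<open>Without an attack the residual is \<open>d\<^sub>n = \<Sum>l\<le>n. G\<^sub>l w\<^sub>n\<^sub>-\<^sub>l + H\<^sub>l \<zeta>\<^sub>n\<^sub>-\<^sub>l\<close>, a moving average of bounded
  independent centred noises, and \<open>R\<^sub>n\<close> is its exact second moment. The constant \<open>S\<close> bounds the averages
  of \<open>Kbar\<^sup>4\<close>, and \<open>Kbar\<close> is nondecreasing, so \<open>Kbar\<close> is bounded; this says that the gains are
  absolutely summable when weighted with the noise bounds (\<open>Kbar_bounded\<close>).

  The entries of \<open>N \<Phi>\<^sub>N\<close> are then sums with the fluctuations of a random walk. What a fixed
  pair of lags contributes to an entry of \<open>d\<^sub>n d\<^sub>n\<^sup>T - R\<^sub>n\<close> is a bounded martingale difference, and so are the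
  products of \<open>d\<^sub>n\<close> with the watermark, which is independent of \<open>d\<close>. Bounded martingale
  differences have partial sums over \<open>n\<close> consecutive times with fourth moment \<open>O(n\<^sup>2)\<close>
  (\<open>fourth_moment_martingale_differences\<close>), and summability of the gains lets the lags be
  added in \<open>L\<^sup>4\<close> (\<open>fourth_moment_product_moving_averages\<close>, \<open>fourth_moment_product_fresh_factor\<close>).

  Such sums are almost surely \<open>o(sqrt (N ln N))\<close> (\<open>partial_sums_small\<close>). Dyadic chaining bounds all
  partial sums up to \<open>2\<^sup>k\<close> with a single fourth moment of order \<open>4\<^sup>k\<close>, and compared with
  \<open>(sqrt (2\<^sup>k k))\<^sup>4\<close> this leaves the summable \<open>1/k\<^sup>2\<close>. Working along blocks of geometric length costs
  only one event per \<open>k\<close>, as in the law of the iterated logarithm, where Borel-Cantelli along all \<open>N\<close> would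
  need a tail bound with sharp constants.

  The threshold \<open>t\<^sub>N\<close> is a positive multiple of \<open>sqrt (N ln N) / N\<close>. Hence almost surely both tests are
  strictly below it from some time on. This makes \<open>limsup E\<close> null, and from that time on the rule never
  switches from \<open>1\<close> to \<open>0\<close>.\<close>

section \<open>Essentially bounded random variables\<close>

text \<open>Every random variable below is essentially bounded. This class is closed under arithmetic and
  contained in the integrable functions, so it discharges all integrability conditions at once.\<close>
definition (in prob_space) bounded_rv :: "('a \<Rightarrow> real) \<Rightarrow> bool" where
  "bounded_rv f \<longleftrightarrow> f \<in> borel_measurable M \<and> (\<exists>c. AE \<omega> in M. \<bar>f \<omega>\<bar> \<le> c)"

context prob_space
begin

lemma bounded_rvI:
  "f \<in> borel_measurable M \<Longrightarrow> AE \<omega> in M. \<bar>f \<omega>\<bar> \<le> c \<Longrightarrow> bounded_rv f"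
  by (auto simp: bounded_rv_def)

lemma bounded_rv_measurable [measurable_dest]: "bounded_rv f \<Longrightarrow> f \<in> borel_measurable M"
  by (simp add: bounded_rv_def)

lemma integrable_bounded_rv: "bounded_rv f \<Longrightarrow> integrable M f"
  unfolding bounded_rv_def by (auto intro!: integrable_const_bound)

lemma bounded_rv_const [intro, simp]: "bounded_rv (\<lambda>_. c)"
  by (auto simp: bounded_rv_def)

lemma bounded_rv_add [intro]:
  assumes "bounded_rv f" "bounded_rv g"
  shows "bounded_rv (\<lambda>\<omega>. f \<omega> + g \<omega>)"
proof -
  obtain c d where "AE \<omega> in M. \<bar>f \<omega>\<bar> \<le> c" "AE \<omega> in M. \<bar>g \<omega>\<bar> \<le> d"
    using assms by (auto simp: bounded_rv_def)
  then have "AE \<omega> in M. \<bar>f \<omega> + g \<omega>\<bar> \<le> c + d"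
    by eventually_elim linarith
  moreover have "f \<in> borel_measurable M" "g \<in> borel_measurable M"
    using assms by (auto simp: bounded_rv_def)
  ultimately show ?thesis
    by (intro bounded_rvI) auto
qed

lemma bounded_rv_mult [intro]:
  assumes "bounded_rv f" "bounded_rv g"
  shows "bounded_rv (\<lambda>\<omega>. f \<omega> * g \<omega>)"
proof -
  obtain c d where "AE \<omega> in M. \<bar>f \<omega>\<bar> \<le> c" "AE \<omega> in M. \<bar>g \<omega>\<bar> \<le> d"
    using assms by (auto simp: bounded_rv_def)
  then have "AE \<omega> in M. \<bar>f \<omega> * g \<omega>\<bar> \<le> c * d"
  proof eventually_elim
    case (elim \<omega>)
    then show ?case
      unfolding abs_mult by (intro mult_mono) auto
  qed
  moreover have "f \<in> borel_measurable M" "g \<in> borel_measurable M"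
    using assms by (auto simp: bounded_rv_def)
  ultimately show ?thesis
    by (intro bounded_rvI) auto
qed

lemma bounded_rv_diff [intro]:
  assumes "bounded_rv f" "bounded_rv g"
  shows "bounded_rv (\<lambda>\<omega>. f \<omega> - g \<omega>)"
  using bounded_rv_add[OF assms(1) bounded_rv_mult[OF bounded_rv_const[of "-1"] assms(2)]] by simp

lemma bounded_rv_power [intro]: "bounded_rv f \<Longrightarrow> bounded_rv (\<lambda>\<omega>. f \<omega> ^ r)"
  by (induction r) auto

lemma bounded_rv_sum [intro]:
  "(\<And>i. i \<in> A \<Longrightarrow> bounded_rv (f i)) \<Longrightarrow> bounded_rv (\<lambda>\<omega>. \<Sum>i\<in>A. f i \<omega>)"
  by (induction A rule: infinite_finite_induct) auto

section \<open>Fourth moments\<close>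

text \<open>The hypothesis \<open>orth\<close> is the part of the martingale difference property that the fourth moment sees:
  expanding \<open>(s + x)\<^sup>4\<close> for a partial sum \<open>s\<close> and its next increment \<open>x\<close>, the terms \<open>s\<^sup>3x\<close> vanish in
  expectation, and \<open>s\<^sup>2x\<^sup>2\<close> is controlled by the second moment of \<open>s\<close>, which grows linearly. Hence the
  fourth moment gains only a linear amount per step.\<close>
lemma fourth_moment_martingale_differences:
  fixes X :: "nat \<Rightarrow> 'a \<Rightarrow> real"
  assumes meas: "\<And>n. X n \<in> borel_measurable M"
    and bound: "\<And>n. AE \<omega> in M. \<bar>X n \<omega>\<bar> \<le> K"
    and orth: "\<And>n r. a \<le> n \<Longrightarrow> expectation (\<lambda>\<omega>. (\<Sum>m=a..<n. X m \<omega>) ^ r * X n \<omega>) = 0"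
  shows "expectation (\<lambda>\<omega>. (\<Sum>m=a..<a + n. X m \<omega>) ^ 4) \<le> 4 * K ^ 4 * (real n)\<^sup>2"
proof -
  define T where "T n \<omega> = (\<Sum>m=a..<a + n. X m \<omega>)" for n \<omega>
  have X: "bounded_rv (X n)" for n
    using meas bound by (rule bounded_rvI)
  have T: "bounded_rv (T n)" for n
    unfolding T_def using X by auto
  have T_Suc: "T (Suc n) \<omega> = T n \<omega> + X (a + n) \<omega>" for n \<omega>
    by (simp add: T_def)
  have orth': "expectation (\<lambda>\<omega>. T n \<omega> ^ r * X (a + n) \<omega>) = 0" for n r
    unfolding T_def by (rule orth) simp
  have second: "expectation (\<lambda>\<omega>. T n \<omega> ^ 2) \<le> K\<^sup>2 * real n" for n
  proof (induction n)
    case 0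
    then show ?case by (simp add: T_def)
  next
    case (Suc n)
    have "expectation (\<lambda>\<omega>. T (Suc n) \<omega> ^ 2)
        \<le> expectation (\<lambda>\<omega>. T n \<omega> ^ 2 + 2 * (T n \<omega> ^ 1 * X (a + n) \<omega>) + K\<^sup>2)"
    proof (rule integral_mono_AE)
      show "AE \<omega> in M. T (Suc n) \<omega> ^ 2 \<le> T n \<omega> ^ 2 + 2 * (T n \<omega> ^ 1 * X (a + n) \<omega>) + K\<^sup>2"
        using bound[of "a + n"]
      proof eventually_elim
        case (elim \<omega>)
        then have "(X (a + n) \<omega>)\<^sup>2 \<le> K\<^sup>2"
          by (metis abs_ge_zero power2_abs power_mono)
        then show ?case
          by (simp add: T_Suc power2_sum)
      qed
    qed (intro integrable_bounded_rv bounded_rv_add bounded_rv_mult bounded_rv_power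
          bounded_rv_const T X)+
    also have "\<dots> = expectation (\<lambda>\<omega>. T n \<omega> ^ 2) + 2 * expectation (\<lambda>\<omega>. T n \<omega> ^ 1 * X (a + n) \<omega>) + K\<^sup>2"
      by (subst Bochner_Integration.integral_add,
          (intro integrable_bounded_rv bounded_rv_add bounded_rv_mult bounded_rv_power
          bounded_rv_const T X)+)+ (simp add: prob_space)
    also have "\<dots> \<le> K\<^sup>2 * real (Suc n)"
      using Suc orth'[of n 1] by (simp add: algebra_simps)
    finally show ?case .
  qed
  have "expectation (\<lambda>\<omega>. T n \<omega> ^ 4) \<le> 4 * K ^ 4 * (real n)\<^sup>2"
  proof (induction n)
    case 0
    then show ?case by (simp add: T_def)
  next
    case (Suc n)
    have "expectation (\<lambda>\<omega>. T (Suc n) \<omega> ^ 4)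
        \<le> expectation (\<lambda>\<omega>. T n \<omega> ^ 4 + 4 * (T n \<omega> ^ 3 * X (a + n) \<omega>)
            + 8 * K\<^sup>2 * T n \<omega> ^ 2 + 3 * K ^ 4)"
    proof (rule integral_mono_AE)
      show "AE \<omega> in M. T (Suc n) \<omega> ^ 4 \<le> T n \<omega> ^ 4 + 4 * (T n \<omega> ^ 3 * X (a + n) \<omega>)
            + 8 * K\<^sup>2 * T n \<omega> ^ 2 + 3 * K ^ 4"
        using bound[of "a + n"]
      proof eventually_elim
        case (elim \<omega>)
        define s x where "s = T n \<omega>" and "x = X (a + n) \<omega>"
        have x: "x\<^sup>2 \<le> K\<^sup>2"
          using elim by (metis abs_ge_zero power2_abs power_mono x_def)
        \<comment> \<open>the odd term \<open>4sx\<^sup>3\<close> is split between its neighbours: \<open>2sx \<le> s\<^sup>2 + x\<^sup>2\<close>\<close>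
        have "(s + x) ^ 4 = s ^ 4 + 4 * (s ^ 3 * x) + 6 * (x\<^sup>2 * s\<^sup>2) + 2 * x\<^sup>2 * (2 * s * x) + x\<^sup>2 * x\<^sup>2"
          by algebra
        also have "\<dots> \<le> s ^ 4 + 4 * (s ^ 3 * x) + 6 * (x\<^sup>2 * s\<^sup>2) + 2 * x\<^sup>2 * (s\<^sup>2 + x\<^sup>2) + x\<^sup>2 * x\<^sup>2"
          using mult_left_mono[OF sum_squares_bound[of s x], of "2 * x\<^sup>2"] by simp
        also have "\<dots> = s ^ 4 + 4 * (s ^ 3 * x) + 8 * (x\<^sup>2 * s\<^sup>2) + 3 * (x\<^sup>2 * x\<^sup>2)"
          by algebra
        also have "\<dots> \<le> s ^ 4 + 4 * (s ^ 3 * x) + 8 * (K\<^sup>2 * s\<^sup>2) + 3 * (K\<^sup>2 * K\<^sup>2)"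
          using mult_right_mono[OF x, of "s\<^sup>2"] mult_mono[OF x x] by simp
        finally show ?case
          by (simp add: T_Suc s_def x_def power4_eq_xxxx power2_eq_square mult.assoc)
      qed
    qed (intro integrable_bounded_rv bounded_rv_add bounded_rv_mult bounded_rv_power
          bounded_rv_const T X)+
    also have "\<dots> = expectation (\<lambda>\<omega>. T n \<omega> ^ 4) + 4 * expectation (\<lambda>\<omega>. T n \<omega> ^ 3 * X (a + n) \<omega>)
        + 8 * K\<^sup>2 * expectation (\<lambda>\<omega>. T n \<omega> ^ 2) + 3 * K ^ 4"
      by (subst Bochner_Integration.integral_add,
          (intro integrable_bounded_rv bounded_rv_add bounded_rv_mult bounded_rv_power
          bounded_rv_const T X)+)+ (simp add: prob_space)
    also have "\<dots> \<le> 4 * K ^ 4 * (real n)\<^sup>2 + 8 * K\<^sup>2 * (K\<^sup>2 * real n) + 3 * K ^ 4"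
      using Suc orth'[of n 3] second[of n] by (intro add_mono mult_left_mono) auto
    also have "\<dots> \<le> 4 * K ^ 4 * (real (Suc n))\<^sup>2"
    proof -
      have "4 * K ^ 4 * (real (Suc n))\<^sup>2 - (4 * K ^ 4 * (real n)\<^sup>2 + 8 * K\<^sup>2 * (K\<^sup>2 * real n) + 3 * K ^ 4) = K ^ 4"
        unfolding of_nat_Suc by algebra
      moreover have "0 \<le> K ^ 4" by simp
      ultimately show ?thesis by linarith
    qed
    finally show ?case .
  qed
  then show ?thesis by (simp add: T_def)
qed

text \<open>Jensen's inequality for \<open>x\<^sup>4\<close> with weights proportional to \<open>c\<close>.\<close>
lemma fourth_power_sum_le:
  fixes f c :: "'i \<Rightarrow> real"
  assumes "finite A" and pos: "\<And>i. i \<in> A \<Longrightarrow> 0 < c i"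
  shows "(\<Sum>i\<in>A. f i) ^ 4 \<le> (\<Sum>i\<in>A. c i) ^ 3 * (\<Sum>i\<in>A. f i ^ 4 / c i ^ 3)"
proof (cases "A = {}")
  case False
  define s where "s = (\<Sum>i\<in>A. c i)"
  have s: "0 < s"
    unfolding s_def using assms False by (intro sum_pos) auto
  have conv: "convex_on UNIV (\<lambda>x::real. x ^ 4)"
    by (rule convex_on_realI[where f' = "\<lambda>x. 4 * x ^ 3"])
       (auto intro!: derivative_eq_intros power_mono_odd)
  have "(\<Sum>i\<in>A. (c i / s) *\<^sub>R (s * f i / c i)) ^ 4 \<le> (\<Sum>i\<in>A. c i / s * (s * f i / c i) ^ 4)"
    using assms False s pos
    by (intro convex_on_sum[OF _ _ conv]) (auto simp: s_def[symmetric] sum_divide_distrib[symmetric] less_imp_le)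
  also have "(\<Sum>i\<in>A. (c i / s) *\<^sub>R (s * f i / c i)) = (\<Sum>i\<in>A. f i)"
  proof (rule sum.cong[OF refl])
    fix i assume "i \<in> A"
    then show "(c i / s) *\<^sub>R (s * f i / c i) = f i"
      using s pos[of i] by (simp add: field_simps)
  qed
  also have "(\<Sum>i\<in>A. c i / s * (s * f i / c i) ^ 4) = s ^ 3 * (\<Sum>i\<in>A. f i ^ 4 / c i ^ 3)"
    unfolding sum_distrib_left
  proof (rule sum.cong[OF refl])
    fix i assume "i \<in> A"
    then show "c i / s * (s * f i / c i) ^ 4 = s ^ 3 * (f i ^ 4 / c i ^ 3)"
      using s pos[of i] by (simp add: field_simps power_mult_distrib power_divide eval_nat_numeral)
  qed
  finally show ?thesis by (simp add: s_def)
qed simp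

text \<open>A form of Minkowski's inequality in \<open>L\<^sup>4\<close>. It reduces a moving average to its single lags.\<close>
lemma fourth_moment_sum_le:
  fixes f :: "'i \<Rightarrow> 'a \<Rightarrow> real"
  assumes "finite A" and pos: "\<And>i. i \<in> A \<Longrightarrow> 0 < c i" and f: "\<And>i. i \<in> A \<Longrightarrow> bounded_rv (f i)"
    and moment: "\<And>i. i \<in> A \<Longrightarrow> expectation (\<lambda>\<omega>. f i \<omega> ^ 4) \<le> D * c i ^ 4"
  shows "expectation (\<lambda>\<omega>. (\<Sum>i\<in>A. f i \<omega>) ^ 4) \<le> D * (\<Sum>i\<in>A. c i) ^ 4"
proof -
  define s where "s = (\<Sum>i\<in>A. c i)"
  have s: "0 \<le> s"
    unfolding s_def using pos by (intro sum_nonneg) (auto intro: less_imp_le)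
  have *: "(\<lambda>\<omega>. f i \<omega> ^ 4 / c i ^ 3) = (\<lambda>\<omega>. f i \<omega> ^ 4 * (1 / c i ^ 3))" for i
    by simp
  have fin: "bounded_rv (\<lambda>\<omega>. f i \<omega> ^ 4 / c i ^ 3)" if "i \<in> A" for i
    unfolding * by (intro bounded_rv_mult bounded_rv_power bounded_rv_const f that)
  have "expectation (\<lambda>\<omega>. (\<Sum>i\<in>A. f i \<omega>) ^ 4) \<le> expectation (\<lambda>\<omega>. s ^ 3 * (\<Sum>i\<in>A. f i \<omega> ^ 4 / c i ^ 3))"
  proof (rule integral_mono)
    show "integrable M (\<lambda>\<omega>. (\<Sum>i\<in>A. f i \<omega>) ^ 4)"
      by (intro integrable_bounded_rv bounded_rv_power bounded_rv_sum f)
    show "integrable M (\<lambda>\<omega>. s ^ 3 * (\<Sum>i\<in>A. f i \<omega> ^ 4 / c i ^ 3))"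
      by (intro integrable_bounded_rv bounded_rv_mult bounded_rv_const bounded_rv_sum fin)
    show "(\<Sum>i\<in>A. f i \<omega>) ^ 4 \<le> s ^ 3 * (\<Sum>i\<in>A. f i \<omega> ^ 4 / c i ^ 3)" for \<omega>
      unfolding s_def by (rule fourth_power_sum_le[OF \<open>finite A\<close> pos])
  qed
  also have "\<dots> = s ^ 3 * (\<Sum>i\<in>A. expectation (\<lambda>\<omega>. f i \<omega> ^ 4) / c i ^ 3)"
    using fin by (simp add: Bochner_Integration.integral_sum integrable_bounded_rv)
  also have "\<dots> \<le> s ^ 3 * (\<Sum>i\<in>A. D * c i)"
  proof (intro mult_left_mono sum_mono)
    fix i assume i: "i \<in> A"
    have "expectation (\<lambda>\<omega>. f i \<omega> ^ 4) / c i ^ 3 \<le> D * c i ^ 4 / c i ^ 3"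
      using moment[OF i] pos[OF i] by (intro divide_right_mono) auto
    also have "\<dots> = D * c i"
      using pos[OF i] by (simp add: eval_nat_numeral)
    finally show "expectation (\<lambda>\<omega>. f i \<omega> ^ 4) / c i ^ 3 \<le> D * c i" .
  qed (use s in auto)
  also have "\<dots> = D * s ^ 4"
    by (simp add: s_def sum_distrib_left[symmetric] eval_nat_numeral)
  finally show ?thesis by (simp add: s_def)
qed

end

section \<open>Dyadic chaining\<close>

text \<open>A number below \<open>2\<^sup>k\<close> is reached from \<open>0\<close> by at most one dyadic step of each length \<open>2\<^sup>j\<close>, so bounds on
  the dyadic increments alone bound all partial sums.\<close>
lemma dyadic_chaining:
  fixes s :: "nat \<Rightarrow> real" and c :: "nat \<Rightarrow> real"
  assumes zero: "s 0 = 0"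
    and incr: "\<And>j i. j < k \<Longrightarrow> i < 2 ^ (k - j) \<Longrightarrow> \<bar>s (Suc i * 2 ^ j) - s (i * 2 ^ j)\<bar> \<le> c j"
    and N: "N < 2 ^ k"
  shows "\<bar>s N\<bar> \<le> (\<Sum>j<k. c j)"
proof -
  have c: "0 \<le> c j" if "j < k" for j
    using incr[of j 0] that by (meson abs_ge_zero order_trans zero_less_numeral zero_less_power)
  \<comment> \<open>clear the binary digits of \<open>N\<close> from the lowest upwards\<close>
  have "\<bar>s N - s (N div 2 ^ j * 2 ^ j)\<bar> \<le> (\<Sum>i<j. c i)" if "j \<le> k" for j
    using that
  proof (induction j)
    case (Suc j)
    define q where "q = N div 2 ^ Suc j"
    have j: "j < k" using Suc.prems by simp
    have half: "q = N div 2 ^ j div 2"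
      by (simp only: q_def power_Suc2 div_mult2_eq)
    have "\<bar>s (N div 2 ^ j * 2 ^ j) - s (q * 2 ^ Suc j)\<bar> \<le> c j"
    proof (cases "even (N div 2 ^ j)")
      case True
      then have "N div 2 ^ j = 2 * q" unfolding half by simp
      then show ?thesis using c[OF j] by (simp add: mult.assoc mult.left_commute)
    next
      case False
      then have eq: "N div 2 ^ j = Suc (2 * q)" unfolding half by simp
      have "N < 2 ^ (k - j) * 2 ^ j"
        using N j by (simp flip: power_add)
      then have "N div 2 ^ j < 2 ^ (k - j)"
        by (simp add: less_mult_imp_div_less)
      then have "2 * q < 2 ^ (k - j)"
        using eq by simp
      from incr[OF j this] show ?thesis
        unfolding eq by (simp add: mult.assoc mult.left_commute)
    qed
    moreover have "\<bar>s N - s (N div 2 ^ j * 2 ^ j)\<bar> \<le> (\<Sum>i<j. c i)"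
      using Suc by simp
    ultimately show ?case
      unfolding q_def[symmetric] sum.lessThan_Suc by linarith
  qed simp
  from this[of k] show ?thesis using N zero by simp
qed

lemma sum_reflect:
  fixes g :: "nat \<Rightarrow> 'b::comm_monoid_add"
  shows "(\<Sum>j<k. g (k - j)) = (\<Sum>j<k. g (Suc j))"
  by (rule sum.reindex_bij_witness[where i = "\<lambda>j. k - Suc j" and j = "\<lambda>j. k - Suc j"])
     (auto simp: Suc_diff_Suc)

text \<open>The quantity in \<open>Q\<close> collects the fourth powers of all dyadic increments below \<open>2\<^sup>k\<close>, scaled by the
  typical size \<open>4\<^sup>k\<close>. The weights \<open>(10/9)\<^bsup>4(k-j)\<^esup>\<close> are a compromise. They make the bounds on the increments
  of length \<open>2\<^sup>j\<close> summable over \<open>j\<close>; and as \<open>(10/9)\<^sup>4 < 2\<close> they grow more slowly than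
  \<open>2\<^bsup>k-j\<^esup>\<close>, the rate at which the expected energy of level \<open>j\<close> decays.\<close>
lemma dyadic_energy_controls_partial_sums:
  fixes s :: "nat \<Rightarrow> real"
  assumes "s 0 = 0" and \<epsilon>: "0 \<le> \<epsilon>"
    and Q: "(\<Sum>j<k. (\<Sum>i<2 ^ (k - j). (10/9) ^ (4 * (k - j)) / 4 ^ k *
                (s (Suc i * 2 ^ j) - s (i * 2 ^ j)) ^ 4)) \<le> \<epsilon> ^ 4 * (real k + 1)\<^sup>2"
    and N: "N < 2 ^ k"
  shows "\<bar>s N\<bar> \<le> 10 * \<epsilon> * sqrt (2 ^ k * (real k + 1))"
proof -
  define b where "b = \<epsilon> * sqrt (2 ^ k * (real k + 1))"
  have b: "0 \<le> b" using \<epsilon> by (simp add: b_def)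
  have "\<bar>s N\<bar> \<le> (\<Sum>j<k. (9/10) ^ (k - j) * b)"
  proof (rule dyadic_chaining[where s = s and k = k, OF assms(1) _ N])
    fix j i :: nat assume j: "j < k" and i: "i < 2 ^ (k - j)"
    define D where "D = s (Suc i * 2 ^ j) - s (i * 2 ^ j)"
    have "(10/9) ^ (4 * (k - j)) / 4 ^ k * D ^ 4
        \<le> (\<Sum>i<2 ^ (k - j). (10/9) ^ (4 * (k - j)) / 4 ^ k * (s (Suc i * 2 ^ j) - s (i * 2 ^ j)) ^ 4)"
      unfolding D_def using i by (intro member_le_sum) auto
    also have "\<dots> \<le> (\<Sum>j<k. (\<Sum>i<2 ^ (k - j). (10/9) ^ (4 * (k - j)) / 4 ^ k *
                (s (Suc i * 2 ^ j) - s (i * 2 ^ j)) ^ 4))"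
      using j by (intro member_le_sum[where f = "\<lambda>j. \<Sum>i<2 ^ (k - j). (10/9) ^ (4 * (k - j)) / 4 ^ k *
                (s (Suc i * 2 ^ j) - s (i * 2 ^ j)) ^ 4"] sum_nonneg) auto
    also note Q
    finally have le: "(10/9) ^ (4 * (k - j)) / 4 ^ k * D ^ 4 \<le> \<epsilon> ^ 4 * (real k + 1)\<^sup>2" .
    have "D ^ 4 = (9/10) ^ (4 * (k - j)) * 4 ^ k * ((10/9) ^ (4 * (k - j)) / 4 ^ k * D ^ 4)"
      by (simp add: power_divide)
    also have "\<dots> \<le> (9/10) ^ (4 * (k - j)) * 4 ^ k * (\<epsilon> ^ 4 * (real k + 1)\<^sup>2)"
      using le by (intro mult_left_mono) auto
    also have "\<dots> = ((9/10) ^ (k - j) * b) ^ 4"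
    proof -
      have "sqrt (2 ^ k * (real k + 1)) ^ 4 = (sqrt (2 ^ k * (real k + 1)) ^ 2) ^ 2"
        by algebra
      also have "\<dots> = (2 ^ k * (real k + 1)) ^ 2"
        by simp
      also have "\<dots> = (2 ^ 2) ^ k * (real k + 1)\<^sup>2"
        unfolding power_mult_distrib power_mult[symmetric] by (simp only: mult.commute)
      finally have root: "sqrt (2 ^ k * (real k + 1)) ^ 4 = 4 ^ k * (real k + 1)\<^sup>2"
        by simp
      show ?thesis
        unfolding b_def power_mult_distrib root power_mult[symmetric]
        by (simp only: mult_ac)
    qed
    finally have "\<bar>D\<bar> ^ 4 \<le> ((9/10) ^ (k - j) * b) ^ 4"
      by simp
    moreover have "0 \<le> (9/10) ^ (k - j) * b"
      using b by simp
    ultimately have "\<bar>D\<bar> \<le> (9/10) ^ (k - j) * b"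
      by (metis abs_ge_zero power_mono_iff zero_less_numeral)
    then show "\<bar>s (Suc i * 2 ^ j) - s (i * 2 ^ j)\<bar> \<le> (9/10) ^ (k - j) * b"
      by (simp only: D_def)
  qed
  also have "\<dots> = (\<Sum>j<k. (9/10) ^ Suc j) * b"
    unfolding sum_distrib_right by (rule sum_reflect)
  also have "\<dots> \<le> 10 * b"
  proof (rule mult_right_mono[OF _ b])
    have "(\<Sum>j<k. (9/10::real) ^ Suc j) = 9 / 10 * (\<Sum>j<k. (9/10) ^ j)"
      by (simp add: sum_distrib_left)
    also have "\<dots> = 9 * (1 - (9/10) ^ k)"
      by (simp add: sum_gp_strict)
    also have "\<dots> \<le> 10" 
      using zero_le_power[of "9/10::real" k] by (simp add: algebra_simps del: zero_le_power)
    finally show "(\<Sum>j<k. (9/10::real) ^ Suc j) \<le> 10" .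
  qed
  finally show ?thesis by (simp add: b_def)
qed

text \<open>Fourth moments of order \<open>n\<^sup>2\<close> give the weighted dyadic energy \<open>Q k\<close> an expectation bounded in \<open>k\<close>.
  Therefore \<open>\<Sum>k. Q k / (k + 1)\<^sup>2\<close> is almost surely finite and \<open>Q k = o(k\<^sup>2)\<close>, which by chaining
  bounds the partial sums up to \<open>2\<^sup>k\<close> by \<open>o(sqrt (2\<^sup>k k))\<close>. The exponent \<open>4\<close> is
  what makes the series converge: a moment of order \<open>p\<close> leaves the factor \<open>k\<^bsup>-p/2\<^esup>\<close>.\<close>
lemma (in prob_space) partial_sums_small:
  fixes X :: "nat \<Rightarrow> 'a \<Rightarrow> real"
  assumes X: "\<And>n. bounded_rv (X n)"
    and moment: "\<And>a n. expectation (\<lambda>\<omega>. (\<Sum>m=a..<a + n. X m \<omega>) ^ 4) \<le> D * (real n)\<^sup>2"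
  shows "AE \<omega> in M. \<forall>\<epsilon>>0. \<forall>\<^sub>F N in sequentially.
           \<bar>\<Sum>n<N. X n \<omega>\<bar> \<le> \<epsilon> * sqrt (real N * ln (real N))"
proof -
  define s where "s N \<omega> = (\<Sum>n<N. X n \<omega>)" for N \<omega>
  define Q where "Q k \<omega> = (\<Sum>j<k. (\<Sum>i<2 ^ (k - j). (10/9) ^ (4 * (k - j)) / 4 ^ k *
                (s (Suc i * 2 ^ j) \<omega> - s (i * 2 ^ j) \<omega>) ^ 4))" for k \<omega>
  have s: "bounded_rv (s N)" for N
    unfolding s_def using X by auto
  have Q: "bounded_rv (Q k)" for k
    unfolding Q_def by (intro bounded_rv_sum bounded_rv_mult bounded_rv_const bounded_rv_power
        bounded_rv_diff s)
  have Q_nonneg: "0 \<le> Q k \<omega>" for k \<omega>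
    unfolding Q_def by (intro sum_nonneg) auto
  have D: "0 \<le> D"
  proof -
    have "0 \<le> expectation (\<lambda>\<omega>. (\<Sum>m=0..<0 + 1. X m \<omega>) ^ 4)"
      by (intro Bochner_Integration.integral_nonneg) simp
    also note moment[of 0 1]
    finally show ?thesis by simp
  qed
  have EQ: "expectation (Q k) \<le> 5 * D" for k
  proof -
    have incr: "expectation (\<lambda>\<omega>. (s (Suc i * 2 ^ j) \<omega> - s (i * 2 ^ j) \<omega>) ^ 4) \<le> D * 4 ^ j" for i j
    proof -
      have "s (Suc i * 2 ^ j) \<omega> - s (i * 2 ^ j) \<omega> = (\<Sum>m=i * 2 ^ j..<i * 2 ^ j + 2 ^ j. X m \<omega>)" for \<omega>
        unfolding s_def lessThan_atLeast0
        by (subst sum_diff_nat_ivl) (auto simp: add.commute)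
      then show ?thesis
        using moment[of "i * 2 ^ j" "2 ^ j"] by (simp add: power2_eq_square power_mult_distrib[symmetric])
    qed
    have "expectation (Q k) = (\<Sum>j<k. (\<Sum>i<2 ^ (k - j). (10/9) ^ (4 * (k - j)) / 4 ^ k *
            expectation (\<lambda>\<omega>. (s (Suc i * 2 ^ j) \<omega> - s (i * 2 ^ j) \<omega>) ^ 4)))"
      unfolding Q_def
      by (subst Bochner_Integration.integral_sum, (intro integrable_bounded_rv bounded_rv_sum bounded_rv_mult
          bounded_rv_const bounded_rv_power bounded_rv_diff s)[1],
        intro sum.cong refl, subst Bochner_Integration.integral_sum, (intro integrable_bounded_rv bounded_rv_sum bounded_rv_mult
          bounded_rv_const bounded_rv_power bounded_rv_diff s)[1]) simp
    also have "\<dots> \<le> (\<Sum>j<k. (\<Sum>i<(2::nat) ^ (k - j). (10/9) ^ (4 * (k - j)) / 4 ^ k * (D * 4 ^ j)))"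
      by (intro sum_mono mult_left_mono incr) auto
    also have "\<dots> = (\<Sum>j<k. D * (5000/6561) ^ (k - j))"
    proof (rule sum.cong[OF refl])
      fix j assume "j \<in> {..<k}"
      then have k: "(4::real) ^ k = 4 ^ (k - j) * 4 ^ j"
        by (simp flip: power_add)
      show "(\<Sum>i<(2::nat) ^ (k - j). (10/9) ^ (4 * (k - j)) / 4 ^ k * (D * 4 ^ j)) = D * (5000/6561) ^ (k - j)"
      proof -
        have eq: "2 ^ q * (r ^ q / (4 ^ q * 4 ^ j) * (D * 4 ^ j)) = D * (r / 2) ^ q" for r :: real and q
        proof -
          have "(4::real) ^ q = 2 ^ q * 2 ^ q"
            by (simp flip: power_mult_distrib)
          then show ?thesis by (simp add: power_divide)
        qed
        have r: "(10/9::real) ^ 4 = 10000/6561" by (simp add: power_divide)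
        show ?thesis
          unfolding k power_mult r using eq[of "k - j" "10000/6561"] by simp
      qed
    qed
    also have "\<dots> = (\<Sum>j<k. D * (5000/6561) ^ Suc j)"
      by (rule sum_reflect)
    also have "\<dots> = D * ((5000/6561) * (\<Sum>j<k. (5000/6561) ^ j))"
      by (simp add: sum_distrib_left)
    also have "\<dots> \<le> D * 5"
    proof (intro mult_left_mono D)
      show "(5000/6561) * (\<Sum>j<k. (5000/6561::real) ^ j) \<le> 5"
      proof -
        define q :: real where "q = 5000/6561"
        have "q * (\<Sum>j<k. q ^ j) = q * ((1 - q ^ k) / (1 - q))"
          by (simp add: sum_gp_strict q_def)
        also have "\<dots> \<le> q * (1 / (1 - q))"
          by (intro mult_left_mono divide_right_mono) (auto simp: q_def)
        also have "\<dots> \<le> 5" by (simp add: q_def)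
        finally show ?thesis by (simp add: q_def)
      qed
    qed
    finally show ?thesis by simp
  qed
  have "(\<integral>\<^sup>+\<omega>. (\<Sum>k. ennreal (Q k \<omega> / (real k + 1)\<^sup>2)) \<partial>M) \<noteq> \<infinity>"
  proof -
    have sq: "summable (\<lambda>k. 5 * D / (real k + 1)\<^sup>2)"
    proof -
      have "summable (\<lambda>k. inverse ((real (Suc k))\<^sup>2))"
        by (subst summable_Suc_iff) (rule inverse_power_summable, simp)
      then have "summable (\<lambda>k. 5 * D * inverse ((real (Suc k))\<^sup>2))"
        by (rule summable_mult)
      then show ?thesis by (simp add: divide_inverse add.commute)
    qed
    have "(\<integral>\<^sup>+\<omega>. (\<Sum>k. ennreal (Q k \<omega> / (real k + 1)\<^sup>2)) \<partial>M)
        = (\<Sum>k. \<integral>\<^sup>+\<omega>. ennreal (Q k \<omega> / (real k + 1)\<^sup>2) \<partial>M)"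
      using Q by (intro nn_integral_suminf) auto
    also have "\<dots> \<le> (\<Sum>k. ennreal (5 * D / (real k + 1)\<^sup>2))"
    proof (rule suminf_le)
      fix k
      have "(\<integral>\<^sup>+\<omega>. ennreal (Q k \<omega> / (real k + 1)\<^sup>2) \<partial>M) = ennreal (expectation (\<lambda>\<omega>. Q k \<omega> / (real k + 1)\<^sup>2))"
        using Q Q_nonneg by (intro nn_integral_eq_integral) (auto intro: integrable_bounded_rv)
      also have "\<dots> \<le> ennreal (5 * D / (real k + 1)\<^sup>2)"
        using EQ[of k] by (simp add: divide_right_mono ennreal_leI)
      finally show "(\<integral>\<^sup>+\<omega>. ennreal (Q k \<omega> / (real k + 1)\<^sup>2) \<partial>M) \<le> ennreal (5 * D / (real k + 1)\<^sup>2)" .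
    qed simp_all
    also have "\<dots> = ennreal (\<Sum>k. 5 * D / (real k + 1)\<^sup>2)"
      using D sq by (intro suminf_ennreal2) auto
    also have "\<dots> < \<infinity>" by simp
    finally show ?thesis by simp
  qed
  then have "AE \<omega> in M. (\<Sum>k. ennreal (Q k \<omega> / (real k + 1)\<^sup>2)) \<noteq> \<infinity>"
    using Q by (intro nn_integral_PInf_AE) auto
  then show ?thesis
  proof eventually_elim
    case (elim \<omega>)
    have "summable (\<lambda>k. Q k \<omega> / (real k + 1)\<^sup>2)"
      using Q_nonneg elim by (intro summable_suminf_not_top) auto
    then have lim: "(\<lambda>k. Q k \<omega> / (real k + 1)\<^sup>2) \<longlonglongrightarrow> 0"
      by (rule summable_LIMSEQ_zero)
    show ?case
    proof (intro allI impI)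
      fix \<epsilon> :: real assume \<epsilon>: "0 < \<epsilon>"
      define \<gamma> where "\<gamma> = \<epsilon> / 40"
      have \<gamma>: "0 < \<gamma>" using \<epsilon> by (simp add: \<gamma>_def)
      have "\<forall>\<^sub>F k in sequentially. Q k \<omega> / (real k + 1)\<^sup>2 < \<gamma> ^ 4"
        using lim \<gamma> by (intro order_tendstoD(2)) auto
      then obtain k0 where k0: "\<And>k. k0 \<le> k \<Longrightarrow> Q k \<omega> / (real k + 1)\<^sup>2 < \<gamma> ^ 4"
        by (auto simp: eventually_sequentially)
      have "\<bar>s N \<omega>\<bar> \<le> \<epsilon> * sqrt (real N * ln (real N))" if N: "2 ^ k0 \<le> N" "2 \<le> N" for N
      proof -
        obtain l where l: "2 ^ l \<le> N" "N < 2 ^ Suc l"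
          using ex_power_ivl1[of 2 N] N by auto
        have l': "2 ^ l \<le> real N"
          using of_nat_mono[OF l(1), where 'a = real] by simp
        have "(2::nat) ^ k0 < 2 ^ Suc l" using N l by linarith
        then have k: "k0 \<le> Suc l" by (simp only: power_strict_increasing_iff)
        have "l \<noteq> 0" using N l by (cases l) auto
        then have "1 \<le> real l" by simp
        have "Q (Suc l) \<omega> \<le> \<gamma> ^ 4 * (real (Suc l) + 1)\<^sup>2"
          using k0[OF k] by (simp add: pos_divide_less_eq)
        then have "\<bar>s N \<omega>\<bar> \<le> 10 * \<gamma> * sqrt (2 ^ Suc l * (real (Suc l) + 1))"
          using \<gamma> l(2) unfolding Q_def
          by (intro dyadic_energy_controls_partial_sums) (auto simp: s_def)
        also have "\<dots> \<le> 10 * \<gamma> * sqrt (16 * (real N * ln (real N)))"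
        proof -
          have "real l * ln 2 = ln (2 ^ l)" by (simp add: ln_realpow)
          also have "\<dots> \<le> ln (real N)"
            using l' N by (subst ln_le_cancel_iff) auto
          finally have "real l * ln 2 \<le> ln (real N)" .
          moreover have "1 / 2 * real l \<le> ln 2 * real l"
            using ln2_ge_two_thirds by (intro mult_right_mono) auto
          ultimately have "real (Suc l) + 1 \<le> 8 * ln (real N)"
            using \<open>1 \<le> real l\<close> mult.commute[of "real l" "ln 2"] unfolding of_nat_Suc by linarith
          moreover have "(2::real) ^ Suc l \<le> 2 * real N"
            using l' by simp
          ultimately have "2 ^ Suc l * (real (Suc l) + 1) \<le> (2 * real N) * (8 * ln (real N))"
            by (metis mult_mono mult_nonneg_nonneg of_nat_0_le_iff zero_le_numeral add_nonneg_nonneg zero_le_one)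
          also have "\<dots> = 16 * (real N * ln (real N))"
            by algebra
          finally show ?thesis
            using \<gamma> by (intro mult_left_mono real_sqrt_le_mono) simp_all
        qed
        also have "\<dots> = \<epsilon> * sqrt (real N * ln (real N))"
          unfolding real_sqrt_mult[of 16] \<gamma>_def by simp
        finally show ?thesis .
      qed
      then show "\<forall>\<^sub>F N in sequentially. \<bar>\<Sum>n<N. X n \<omega>\<bar> \<le> \<epsilon> * sqrt (real N * ln (real N))"
        unfolding eventually_sequentially s_def by (intro exI[of _ "max (2 ^ k0) 2"]) simp
    qed
  qed
qed

section \<open>Independent sources\<close>

text \<open>Glues two independent families that are independent of each other. It is applied twice to merge
  the process noise, the measurement noise and the watermark into a single family.\<close>
lemma (in prob_space) indep_sets_Plus:
  assumes F: "indep_sets F I" and G: "indep_sets G J"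
    and FG: "indep_set (sigma_sets (space M) (\<Union>i\<in>I. F i)) (sigma_sets (space M) (\<Union>j\<in>J. G j))"
  shows "indep_sets (case_sum F G) (I <+> J)"
proof (rule indep_setsI)
  fix i assume "i \<in> I <+> J"
  moreover have "\<forall>i\<in>I. F i \<subseteq> events" "\<forall>j\<in>J. G j \<subseteq> events"
    using F G unfolding indep_sets_def by blast+
  ultimately show "case_sum F G i \<subseteq> events"
    by (elim PlusE) simp_all
next
  fix A K assume K: "K \<noteq> {}" "K \<subseteq> I <+> J" "finite K" and A: "\<forall>k\<in>K. A k \<in> case_sum F G k"
  define K1 K2 where "K1 = Inl -` K" and "K2 = Inr -` K"
  have K_eq: "K = Inl ` K1 \<union> Inr ` K2"
    unfolding K1_def K2_def using K(2) by auto
  have fin: "finite K1" "finite K2"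
    unfolding K1_def K2_def using K(3) by (auto intro: finite_vimageI)
  have sub: "K1 \<subseteq> I" "K2 \<subseteq> J"
    using K(2) by (auto simp: K1_def K2_def)
  have A1: "A (Inl i) \<in> F i" if "i \<in> K1" for i
    using A that by (force simp: K1_def)
  have A2: "A (Inr j) \<in> G j" if "j \<in> K2" for j
    using A that by (force simp: K2_def)
  have p1: "prob (\<Inter>i\<in>K1. A (Inl i)) = (\<Prod>i\<in>K1. prob (A (Inl i)))" if "K1 \<noteq> {}"
    using indep_setsD[OF F sub(1) that fin(1)] A1 by auto
  have p2: "prob (\<Inter>j\<in>K2. A (Inr j)) = (\<Prod>j\<in>K2. prob (A (Inr j)))" if "K2 \<noteq> {}"
    using indep_setsD[OF G sub(2) that fin(2)] A2 by auto
  have prod: "(\<Prod>k\<in>K. prob (A k)) = (\<Prod>i\<in>K1. prob (A (Inl i))) * (\<Prod>j\<in>K2. prob (A (Inr j)))"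
    unfolding K_eq using fin
    by (subst prod.union_disjoint) (auto simp: prod.reindex)
  show "prob (\<Inter>k\<in>K. A k) = (\<Prod>k\<in>K. prob (A k))"
  proof (cases "K1 = {} \<or> K2 = {}")
    case True
    then show ?thesis
    proof
      assume "K1 = {}"
      moreover have "K = Inr ` K2" using K_eq calculation by simp
      moreover have "K2 \<noteq> {}" using K(1) calculation by simp
      ultimately show ?thesis
        using p2 unfolding prod by (simp add: image_image)
    next
      assume "K2 = {}"
      moreover have "K = Inl ` K1" using K_eq calculation by simp
      moreover have "K1 \<noteq> {}" using K(1) calculation by simp
      ultimately show ?thesis
        using p1 unfolding prod by (simp add: image_image)
    qed
  next
    case False
    have gen1: "(\<Inter>i\<in>K1. A (Inl i)) \<in> sigma_sets (space M) (\<Union>i\<in>I. F i)"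
    proof -
      interpret sigma_algebra "space M" "sigma_sets (space M) (\<Union>i\<in>I. F i)"
        using F sets.space_closed unfolding indep_sets_def by (intro sigma_algebra_sigma_sets) blast
      show ?thesis
      proof (intro finite_INT)
        show "A (Inl i) \<in> sigma_sets (space M) (\<Union>i\<in>I. F i)" if "i \<in> K1" for i
          using A1[OF that] sub that by (intro sigma_sets.Basic) blast
      qed (use False fin in auto)
    qed
    have gen2: "(\<Inter>j\<in>K2. A (Inr j)) \<in> sigma_sets (space M) (\<Union>j\<in>J. G j)"
    proof -
      interpret sigma_algebra "space M" "sigma_sets (space M) (\<Union>j\<in>J. G j)"
        using G sets.space_closed unfolding indep_sets_def by (intro sigma_algebra_sigma_sets) blast
      show ?thesis
      proof (intro finite_INT)
        show "A (Inr j) \<in> sigma_sets (space M) (\<Union>j\<in>J. G j)" if "j \<in> K2" for j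
          using A2[OF that] sub that by (intro sigma_sets.Basic) blast
      qed (use False fin in auto)
    qed
    have "(\<Inter>k\<in>K. A k) = (\<Inter>i\<in>K1. A (Inl i)) \<inter> (\<Inter>j\<in>K2. A (Inr j))"
      unfolding K_eq by auto
    then show ?thesis
      using indep_setD[OF FG gen1 gen2] p1 p2 False prod by simp
  qed
qed

text \<open>Independent families of events, indexed by the source of randomness. The \<open>\<sigma>\<close>-algebra generated by a
  set \<open>I\<close> of sources is \<open>info I\<close>; past and present are encoded as disjoint sets of sources, which
  takes the place of a filtration and of conditional expectations.\<close>
locale independent_sources = prob_space +
  fixes G :: "'i \<Rightarrow> 'a set set" and J :: "'i set"
  assumes indep: "indep_sets G J"
    and Int_stable: "\<And>i. i \<in> J \<Longrightarrow> Int_stable (G i)"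
begin

definition info :: "'i set \<Rightarrow> 'a measure" where
  "info I = sigma (space M) (\<Union>i\<in>I. G i)"

lemma sources_subset: "I \<subseteq> J \<Longrightarrow> (\<Union>i\<in>I. G i) \<subseteq> Pow (space M)"
  using indep sets.space_closed[of M] unfolding indep_sets_def by (intro UN_least) (meson order_trans subsetD)

lemma sets_info: "I \<subseteq> J \<Longrightarrow> sets (info I) = sigma_sets (space M) (\<Union>i\<in>I. G i)"
  unfolding info_def by (rule sets_measure_of[OF sources_subset])

lemma space_info [simp]: "space (info I) = space M"
  by (simp add: info_def space_measure_of_conv)

lemma measurable_info_mono:
  assumes "I \<subseteq> I'" "I' \<subseteq> J" "f \<in> measurable (info I) N"
  shows "f \<in> measurable (info I') N"
proof -
  have "sets (info I) \<subseteq> sets (info I')"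
    unfolding sets_info[OF assms(2)] sets_info[OF order_trans[OF assms(1,2)]]
    using assms(1) by (intro sigma_sets_mono') blast
  then show ?thesis
    using measurable_mono[of N N "info I" "info I'"] assms(3) by auto
qed

lemma measurable_info:
  assumes "I \<subseteq> J" "f \<in> measurable (info I) N"
  shows "f \<in> measurable M N"
proof -
  have "sets (info I) \<subseteq> sets M"
    unfolding sets_info[OF assms(1)]
    using assms(1) indep unfolding indep_sets_def by (intro sets.sigma_sets_subset) blast
  then show ?thesis
    using measurable_mono[of N N "info I" M] assms(2) by auto
qed

lemma expectation_mult_disjoint:
  fixes f g :: "'a \<Rightarrow> real"
  assumes "I1 \<subseteq> J" "I2 \<subseteq> J" "I1 \<inter> I2 = {}"
    and f: "f \<in> borel_measurable (info I1)" "bounded_rv f"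
    and g: "g \<in> borel_measurable (info I2)" "bounded_rv g"
  shows "expectation (\<lambda>\<omega>. f \<omega> * g \<omega>) = expectation f * expectation g"
proof (rule indep_var_lebesgue_integral)
  define I where "I = case_bool I1 I2"
  have "indep_sets (\<lambda>b. sigma_sets (space M) (\<Union>i\<in>I b. G i)) UNIV"
  proof (rule indep_sets_collect_sigma)
    show "indep_sets G (\<Union>b\<in>UNIV. I b)"
      using assms by (intro indep_sets_mono_index[OF _ indep]) (auto simp: I_def split: bool.splits)
    show "Int_stable (G i)" if "i \<in> I b" for i b
      using that assms by (intro Int_stable) (auto simp: I_def split: bool.splits)
    show "disjoint_family I"
      using assms by (auto simp: I_def disjoint_family_on_def split: bool.splits)
  qed
  then have ind: "indep_set (sets (info I1)) (sets (info I2))"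
    unfolding indep_set_def
    by (rule indep_sets_mono_sets) (use assms in \<open>auto simp: I_def sets_info split: bool.splits\<close>)
  have gen: "sigma_sets (space M) {h -` A \<inter> space M |A. A \<in> sets borel} \<subseteq> sets (info I')"
    if "h \<in> borel_measurable (info I')" for h :: "'a \<Rightarrow> real" and I'
    using that sets.sigma_sets_subset[of "{h -` A \<inter> space M |A. A \<in> sets borel}" "info I'"]
    by (auto simp: measurable_def)
  have "indep_set (sigma_sets (space M) {f -` A \<inter> space M |A. A \<in> sets borel})
      (sigma_sets (space M) {g -` A \<inter> space M |A. A \<in> sets borel})"
  proof (rule indep_setI)
    show "sigma_sets (space M) {f -` A \<inter> space M |A. A \<in> sets borel} \<subseteq> events"
      using gen[OF f(1)] indep_setD_ev1[OF ind] by (rule order_trans)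
    show "sigma_sets (space M) {g -` A \<inter> space M |A. A \<in> sets borel} \<subseteq> events"
      using gen[OF g(1)] indep_setD_ev2[OF ind] by (rule order_trans)
  qed (rule indep_setD[OF ind subsetD[OF gen[OF f(1)]] subsetD[OF gen[OF g(1)]]])
  then show "indep_var borel f borel g"
    using f g by (simp add: indep_var_eq bounded_rv_def)
qed (use f g integrable_bounded_rv in auto)

lemma expectation_mult_centred:
  fixes f g :: "'a \<Rightarrow> real"
  assumes "I1 \<subseteq> J" "I2 \<subseteq> J" "I1 \<inter> I2 = {}"
    and "f \<in> borel_measurable (info I1)" "bounded_rv f"
    and "g \<in> borel_measurable (info I2)" "bounded_rv g" "expectation g = 0"
  shows "expectation (\<lambda>\<omega>. f \<omega> * g \<omega>) = 0"
  using expectation_mult_disjoint[OF assms(1-7)] assms(8) by simp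

section \<open>Products of moving averages\<close>

text \<open>The product of two moving averages of independent blocks splits into terms indexed by a pair of
  lags \<open>(l, l')\<close>. For a fixed pair the centred terms are martingale differences: if \<open>l \<noteq> l'\<close>, the
  factor of smaller lag belongs to a block that is later than everything else in the partial sum and
  has mean zero; if \<open>l = l'\<close>, the centred product as a whole has these two properties. The pair contributes at
  most \<open>h l * h l'\<close> to the \<open>L\<^sup>4\<close> norm, and the sum over all pairs is at most \<open>H\<^sup>2\<close>.\<close>
lemma fourth_moment_product_moving_averages:
  fixes a b :: "nat \<Rightarrow> nat \<Rightarrow> 'a \<Rightarrow> real" and blk :: "nat \<Rightarrow> 'i set" and h :: "nat \<Rightarrow> real"
  assumes blk: "\<And>k. blk k \<subseteq> J" "disjoint_family blk"
    and a_meas: "\<And>l k. a l k \<in> borel_measurable (info (blk k))"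
    and b_meas: "\<And>l k. b l k \<in> borel_measurable (info (blk k))"
    and a_bound: "\<And>l k. AE \<omega> in M. \<bar>a l k \<omega>\<bar> \<le> h l"
    and b_bound: "\<And>l k. AE \<omega> in M. \<bar>b l k \<omega>\<bar> \<le> h l"
    and a_mean: "\<And>l k. expectation (a l k) = 0"
    and b_mean: "\<And>l k. expectation (b l k) = 0"
    and h_pos: "\<And>l. 0 < h l" and H: "\<And>n. (\<Sum>l\<le>n. h l) \<le> H"
  defines "X \<equiv> \<lambda>n \<omega>. (\<Sum>l\<le>n. a l (n - l) \<omega>) * (\<Sum>l\<le>n. b l (n - l) \<omega>)"
  shows "expectation (\<lambda>\<omega>. (\<Sum>m=c..<c + n. X m \<omega> - expectation (X m)) ^ 4) \<le> 64 * H ^ 8 * (real n)\<^sup>2"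
proof -
  define d where "d = c + n"
  \<comment> \<open>the term of lag \<open>l\<close> in the moving average at time \<open>m\<close>, zero when it would reach back before time \<open>0\<close>\<close>
  define a' where "a' l m \<omega> = (if l \<le> m then a l (m - l) \<omega> else 0)" for l m \<omega>
  define b' where "b' l m \<omega> = (if l \<le> m then b l (m - l) \<omega> else 0)" for l m \<omega>
  define Y where "Y p m \<omega> = a' (fst p) m \<omega> * b' (snd p) m \<omega>
      - expectation (\<lambda>\<omega>. a' (fst p) m \<omega> * b' (snd p) m \<omega>)" for p m \<omega>
  define past where "past k = (\<Union>j<k. blk j)" for k
  have past: "past k \<subseteq> J" for k
    using blk by (auto simp: past_def)
  have disj: "past k \<inter> blk k = {}" for k
  proof -
    have "blk j \<inter> blk k = {}" if "j < k" for j
      using blk(2) that by (intro disjoint_family_onD[where I = UNIV]) auto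
    then show ?thesis unfolding past_def by blast
  qed

  have a': "a' l m \<in> borel_measurable (info (past k))" if "m < k + l" for l m k
  proof (cases "l \<le> m")
    case True
    have "m - l < k" using True that by linarith
    then have "blk (m - l) \<subseteq> past k" unfolding past_def by blast
    then have "a l (m - l) \<in> borel_measurable (info (past k))"
      by (rule measurable_info_mono[OF _ past a_meas])
    then show ?thesis using True by (simp add: a'_def[abs_def])
  qed (simp add: a'_def[abs_def])
  have b': "b' l m \<in> borel_measurable (info (past k))" if "m < k + l" for l m k
  proof (cases "l \<le> m")
    case True
    have "m - l < k" using True that by linarith
    then have "blk (m - l) \<subseteq> past k" unfolding past_def by blast
    then have "b l (m - l) \<in> borel_measurable (info (past k))"
      by (rule measurable_info_mono[OF _ past b_meas])
    then show ?thesis using True by (simp add: b'_def[abs_def])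
  qed (simp add: b'_def[abs_def])
  have a'_rv: "a' l m \<in> borel_measurable M" for l m
    by (rule measurable_info[OF past a'[of m "Suc m" l]]) simp
  have b'_rv: "b' l m \<in> borel_measurable M" for l m
    by (rule measurable_info[OF past b'[of m "Suc m" l]]) simp
  have a'_bound: "AE \<omega> in M. \<bar>a' l m \<omega>\<bar> \<le> h l" for l m
    using a_bound[of l "m - l"] h_pos[of l] by (cases "l \<le> m") (simp_all add: a'_def less_imp_le)
  have b'_bound: "AE \<omega> in M. \<bar>b' l m \<omega>\<bar> \<le> h l" for l m
    using b_bound[of l "m - l"] h_pos[of l] by (cases "l \<le> m") (simp_all add: b'_def less_imp_le)
  have a'_bdd: "bounded_rv (a' l m)" for l m
    using a'_rv a'_bound by (rule bounded_rvI)
  have b'_bdd: "bounded_rv (b' l m)" for l m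
    using b'_rv b'_bound by (rule bounded_rvI)
  have a'_mean: "expectation (a' l m) = 0" for l m
    using a_mean[of l "m - l"] by (cases "l \<le> m") (simp_all add: a'_def[abs_def])
  have b'_mean: "expectation (b' l m) = 0" for l m
    using b_mean[of l "m - l"] by (cases "l \<le> m") (simp_all add: b'_def[abs_def])
  have Y_bdd: "bounded_rv (Y p m)" for p m
    unfolding Y_def by (intro bounded_rv_diff bounded_rv_mult bounded_rv_const a'_bdd b'_bdd)

  have prod_bound: "AE \<omega> in M. \<bar>a' l m \<omega> * b' l' m \<omega>\<bar> \<le> h l * h l'" for l l' m
    using a'_bound[of l m] b'_bound[of l' m]
  proof eventually_elim
    case (elim \<omega>)
    then show ?case
      unfolding abs_mult using h_pos[of l] by (intro mult_mono) auto
  qed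
  have Y_bound: "AE \<omega> in M. \<bar>Y p m \<omega>\<bar> \<le> 2 * (h (fst p) * h (snd p))" for p m
  proof -
    have "\<bar>expectation (\<lambda>\<omega>. a' (fst p) m \<omega> * b' (snd p) m \<omega>)\<bar>
        \<le> expectation (\<lambda>\<omega>. \<bar>a' (fst p) m \<omega> * b' (snd p) m \<omega>\<bar>)"
      by (rule integral_abs_bound)
    also have "\<dots> \<le> expectation (\<lambda>_. h (fst p) * h (snd p))"
      by (intro integral_mono_AE prod_bound integrable_abs integrable_bounded_rv bounded_rv_mult a'_bdd b'_bdd
          bounded_rv_const)
    also have "\<dots> = h (fst p) * h (snd p)" by (simp add: prob_space)
    finally have "\<bar>expectation (\<lambda>\<omega>. a' (fst p) m \<omega> * b' (snd p) m \<omega>)\<bar> \<le> h (fst p) * h (snd p)" .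
    with prod_bound[of "fst p" m "snd p"] show ?thesis
      unfolding Y_def by (auto elim!: eventually_mono)
  qed

  have orth: "expectation (\<lambda>\<omega>. (\<Sum>m=c..<m'. Y p m \<omega>) ^ r * Y p m' \<omega>) = 0" if "c \<le> m'" for p m' r
  proof -
    define l l' where "l = fst p" and "l' = snd p"
    define T where "T \<omega> = (\<Sum>m=c..<m'. Y p m \<omega>) ^ r" for \<omega>
    have T_bdd: "bounded_rv T"
      unfolding T_def by (intro bounded_rv_power bounded_rv_sum Y_bdd)
    have T_meas: "T \<in> borel_measurable (info (past (m' - min l l')))" if "min l l' \<le> m'"
    proof -
      have "Y p m \<in> borel_measurable (info (past (m' - min l l')))" if "m < m'" for m
      proof -
        have "a' l m \<in> borel_measurable (info (past (m' - min l l')))"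
          using that \<open>min l l' \<le> m'\<close> by (intro a') linarith
        moreover have "b' l' m \<in> borel_measurable (info (past (m' - min l l')))"
          using that \<open>min l l' \<le> m'\<close> by (intro b') linarith
        ultimately show ?thesis
          unfolding Y_def l_def[symmetric] l'_def[symmetric] by simp
      qed
      then show ?thesis
        unfolding T_def by (intro borel_measurable_power borel_measurable_sum) simp
    qed
    consider (late) "m' < max l l'" | (eq) "l = l'" "l \<le> m'"
      | (less) "l < l'" "l' \<le> m'" | (greater) "l' < l" "l \<le> m'"
      by atomize_elim arith
    then show ?thesis
    proof cases
      case late
      then have "(\<lambda>\<omega>. a' l m' \<omega> * b' l' m' \<omega>) = (\<lambda>_. 0)"
        by (cases "l \<le> m'"; cases "l' \<le> m'") (simp_all add: a'_def b'_def)
      then have "Y p m' \<omega> = 0" for \<omega>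
        unfolding Y_def l_def[symmetric] l'_def[symmetric] by (metis (mono_tags) Bochner_Integration.integral_zero diff_self)
      then show ?thesis by simp
    next
      case eq
      have "Y p m' \<in> borel_measurable (info (blk (m' - l)))"
      proof -
        have "a' l m' \<in> borel_measurable (info (blk (m' - l)))" "b' l m' \<in> borel_measurable (info (blk (m' - l)))"
          using eq a_meas b_meas by (simp_all add: a'_def[abs_def] b'_def[abs_def])
        then show ?thesis
          using eq(1) unfolding Y_def l_def[symmetric] l'_def[symmetric] by simp
      qed
      moreover have "expectation (Y p m') = 0"
        unfolding Y_def
        by (subst Bochner_Integration.integral_diff,
            (intro integrable_bounded_rv bounded_rv_mult a'_bdd b'_bdd bounded_rv_const)+)
           (simp add: prob_space)
      ultimately show ?thesis
        using expectation_mult_centred[OF past blk(1) disj _ T_bdd _ Y_bdd, of "m' - l" p m'] eq T_meas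
        by (simp add: T_def)
    next
      case less
      \<comment> \<open>the factor \<open>a\<close> is the most recent one\<close>
      have a_now: "a' l m' \<in> borel_measurable (info (blk (m' - l)))"
        using less a_meas by (simp add: a'_def[abs_def])
      have b_past: "b' l' m' \<in> borel_measurable (info (past (m' - l)))"
        using less by (intro b') auto
      have "expectation (\<lambda>\<omega>. b' l' m' \<omega> * a' l m' \<omega>) = 0"
        by (rule expectation_mult_centred[OF past blk(1) disj b_past b'_bdd a_now a'_bdd a'_mean])
      then have "expectation (\<lambda>\<omega>. T \<omega> * Y p m' \<omega>) = expectation (\<lambda>\<omega>. (T \<omega> * b' l' m' \<omega>) * a' l m' \<omega>)"
        by (simp add: Y_def l_def l'_def mult_ac)
      also have "\<dots> = 0"
      proof (rule expectation_mult_centred[OF past blk(1) disj _ _ a_now a'_bdd a'_mean])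
        show "(\<lambda>\<omega>. T \<omega> * b' l' m' \<omega>) \<in> borel_measurable (info (past (m' - l)))"
          using T_meas less b_past by (intro borel_measurable_times) auto
        show "bounded_rv (\<lambda>\<omega>. T \<omega> * b' l' m' \<omega>)"
          using T_bdd b'_bdd by (rule bounded_rv_mult)
      qed
      finally show ?thesis by (simp add: T_def)
    next
      case greater
      have b_now: "b' l' m' \<in> borel_measurable (info (blk (m' - l')))"
        using greater b_meas by (simp add: b'_def[abs_def])
      have a_past: "a' l m' \<in> borel_measurable (info (past (m' - l')))"
        using greater by (intro a') auto
      have "expectation (\<lambda>\<omega>. a' l m' \<omega> * b' l' m' \<omega>) = 0"
        by (rule expectation_mult_centred[OF past blk(1) disj a_past a'_bdd b_now b'_bdd b'_mean])
      then have "expectation (\<lambda>\<omega>. T \<omega> * Y p m' \<omega>) = expectation (\<lambda>\<omega>. (T \<omega> * a' l m' \<omega>) * b' l' m' \<omega>)"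
        by (simp add: Y_def l_def l'_def mult_ac)
      also have "\<dots> = 0"
      proof (rule expectation_mult_centred[OF past blk(1) disj _ _ b_now b'_bdd b'_mean])
        show "(\<lambda>\<omega>. T \<omega> * a' l m' \<omega>) \<in> borel_measurable (info (past (m' - l')))"
          using T_meas greater a_past by (intro borel_measurable_times) auto
        show "bounded_rv (\<lambda>\<omega>. T \<omega> * a' l m' \<omega>)"
          using T_bdd a'_bdd by (rule bounded_rv_mult)
      qed
      finally show ?thesis by (simp add: T_def)
    qed
  qed

  have moment: "expectation (\<lambda>\<omega>. (\<Sum>m=c..<c + n. Y p m \<omega>) ^ 4)
      \<le> 64 * (real n)\<^sup>2 * (h (fst p) * h (snd p)) ^ 4" for p
  proof -
    have "expectation (\<lambda>\<omega>. (\<Sum>m=c..<c + n. Y p m \<omega>) ^ 4)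
        \<le> 4 * (2 * (h (fst p) * h (snd p))) ^ 4 * (real n)\<^sup>2"
      using Y_bdd Y_bound orth by (intro fourth_moment_martingale_differences) (auto simp: bounded_rv_def)
    then show ?thesis by (simp add: power_mult_distrib mult_ac)
  qed

  have X_eq: "X m \<omega> = (\<Sum>p\<in>{..<d} \<times> {..<d}. a' (fst p) m \<omega> * b' (snd p) m \<omega>)" if "m < d" for m \<omega>
  proof -
    have "(\<Sum>l\<le>m. a l (m - l) \<omega>) = (\<Sum>l<d. a' l m \<omega>)"
      unfolding a'_def using that by (intro sum.mono_neutral_cong_left) auto
    moreover have "(\<Sum>l\<le>m. b l (m - l) \<omega>) = (\<Sum>l<d. b' l m \<omega>)"
      unfolding b'_def using that by (intro sum.mono_neutral_cong_left) auto
    ultimately have "X m \<omega> = (\<Sum>l<d. a' l m \<omega>) * (\<Sum>l<d. b' l m \<omega>)"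
      by (simp only: X_def)
    then show ?thesis
      by (simp add: sum_product sum.cartesian_product case_prod_unfold)
  qed
  have centred: "X m \<omega> - expectation (X m) = (\<Sum>p\<in>{..<d} \<times> {..<d}. Y p m \<omega>)" if "m < d" for m \<omega>
  proof -
    have "expectation (X m) = (\<Sum>p\<in>{..<d} \<times> {..<d}. expectation (\<lambda>\<omega>. a' (fst p) m \<omega> * b' (snd p) m \<omega>))"
      unfolding X_eq[OF that, abs_def]
      by (intro Bochner_Integration.integral_sum integrable_bounded_rv bounded_rv_mult a'_bdd b'_bdd)
    then show ?thesis
      by (simp add: X_eq[OF that] Y_def sum_subtractf)
  qed
  have "(\<Sum>m=c..<c + n. X m \<omega> - expectation (X m)) = (\<Sum>p\<in>{..<d} \<times> {..<d}. \<Sum>m=c..<c + n. Y p m \<omega>)" for \<omega>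
    by (subst sum.swap) (auto intro!: sum.cong simp: centred d_def)
  then have "expectation (\<lambda>\<omega>. (\<Sum>m=c..<c + n. X m \<omega> - expectation (X m)) ^ 4)
      = expectation (\<lambda>\<omega>. (\<Sum>p\<in>{..<d} \<times> {..<d}. \<Sum>m=c..<c + n. Y p m \<omega>) ^ 4)"
    by simp
  also have "\<dots> \<le> 64 * (real n)\<^sup>2 * (\<Sum>p\<in>{..<d} \<times> {..<d}. h (fst p) * h (snd p)) ^ 4"
    using h_pos moment by (intro fourth_moment_sum_le bounded_rv_sum Y_bdd) auto
  also have "(\<Sum>p\<in>{..<d} \<times> {..<d}. h (fst p) * h (snd p)) = (\<Sum>l<d. h l)\<^sup>2"
    by (simp add: power2_eq_square sum_product sum.cartesian_product case_prod_unfold)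
  also have "64 * (real n)\<^sup>2 * ((\<Sum>l<d. h l)\<^sup>2) ^ 4 \<le> 64 * (real n)\<^sup>2 * H ^ 8"
  proof (rule mult_left_mono)
    have "(\<Sum>l<d. h l) \<le> (\<Sum>l\<le>d. h l)"
      using h_pos by (intro sum_mono2) (auto intro: less_imp_le)
    then have "(\<Sum>l<d. h l) ^ 8 \<le> H ^ 8"
      using h_pos H[of d] by (intro power_mono sum_nonneg) (auto intro: less_imp_le)
    then show "((\<Sum>l<d. h l)\<^sup>2) ^ 4 \<le> H ^ 8" by (simp flip: power_mult)
  qed simp
  finally show ?thesis by (simp add: mult_ac)
qed

end

text \<open>The case of the watermark: each summand contains a centred factor from a source of its own that
  affects neither the process \<open>f\<close> nor the other summands.\<close>
lemma (in independent_sources) fourth_moment_product_fresh_factor: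
  fixes f g :: "nat \<Rightarrow> 'a \<Rightarrow> real" and j :: "nat \<Rightarrow> 'i"
  assumes I0: "I0 \<subseteq> J" and j: "range j \<subseteq> J" "inj j" "range j \<inter> I0 = {}"
    and f_meas: "\<And>n. f n \<in> borel_measurable (info I0)"
    and g_meas: "\<And>n. g n \<in> borel_measurable (info {j n})"
    and f_bound: "\<And>n. AE \<omega> in M. \<bar>f n \<omega>\<bar> \<le> F"
    and g_bound: "\<And>n. AE \<omega> in M. \<bar>g n \<omega>\<bar> \<le> H"
    and g_mean: "\<And>n. expectation (g n) = 0"
  shows "expectation (\<lambda>\<omega>. (\<Sum>m=c..<c + n. f m \<omega> * g m \<omega>) ^ 4) \<le> 4 * (F * H) ^ 4 * (real n)\<^sup>2"
proof (rule fourth_moment_martingale_differences)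
  have f_rv: "f n \<in> borel_measurable M" for n
    by (rule measurable_info[OF I0 f_meas])
  have g_rv: "g n \<in> borel_measurable M" for n
    by (rule measurable_info[OF _ g_meas]) (use j in auto)
  have f_bdd: "bounded_rv (f n)" for n
    using f_rv f_bound by (rule bounded_rvI)
  have g_bdd: "bounded_rv (g n)" for n
    using g_rv g_bound by (rule bounded_rvI)
  show "(\<lambda>\<omega>. f n \<omega> * g n \<omega>) \<in> borel_measurable M" for n
    using f_rv g_rv by simp
  show "AE \<omega> in M. \<bar>f n \<omega> * g n \<omega>\<bar> \<le> F * H" for n
    using f_bound[of n] g_bound[of n]
  proof eventually_elim
    case (elim \<omega>)
    then show ?case unfolding abs_mult by (intro mult_mono) auto
  qed
  show "expectation (\<lambda>\<omega>. (\<Sum>m=c..<n. f m \<omega> * g m \<omega>) ^ r * (f n \<omega> * g n \<omega>)) = 0" for n r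
  proof -
    define past where "past = I0 \<union> j ` {..<n}"
    define T where "T \<omega> = (\<Sum>m=c..<n. f m \<omega> * g m \<omega>) ^ r * f n \<omega>" for \<omega>
    have past: "past \<subseteq> J" "past \<inter> {j n} = {}" "{j n} \<subseteq> J"
    proof -
      have "j n \<notin> I0" using j(3) by blast
      then show "past \<subseteq> J" "past \<inter> {j n} = {}" "{j n} \<subseteq> J"
        using I0 j(1,2) by (auto simp: past_def inj_eq)
    qed
    have f_past: "f m \<in> borel_measurable (info past)" for m
      by (rule measurable_info_mono[OF _ past(1) f_meas]) (simp add: past_def)
    have g_past: "g m \<in> borel_measurable (info past)" if "m < n" for m
      by (rule measurable_info_mono[OF _ past(1) g_meas]) (use that in \<open>simp add: past_def\<close>)
    have "T \<in> borel_measurable (info past)"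
      unfolding T_def
      by (intro borel_measurable_times borel_measurable_power borel_measurable_sum f_past g_past) simp
    moreover have "bounded_rv T"
      unfolding T_def by (intro bounded_rv_mult bounded_rv_power bounded_rv_sum f_bdd g_bdd)
    ultimately have "expectation (\<lambda>\<omega>. T \<omega> * g n \<omega>) = 0"
      by (intro expectation_mult_centred[OF past(1,3,2)] g_meas g_bdd g_mean)
    then show ?thesis by (simp add: T_def mult_ac)
  qed
qed

section \<open>Matrix averages and the threshold\<close>

lemma norm_mult_vec_le_spec_norm: "norm (X *v x) \<le> spec_norm X * norm x"
  unfolding spec_norm_def by (rule onorm[OF matrix_vector_mul_bounded_linear])

lemma spec_norm_nonneg: "0 \<le> spec_norm X"
  unfolding spec_norm_def by (rule onorm_pos_le[OF matrix_vector_mul_bounded_linear])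

lemma spec_norm_le_entries: "spec_norm X \<le> (\<Sum>i\<in>UNIV. \<Sum>j\<in>UNIV. \<bar>X $ i $ j\<bar>)"
  unfolding spec_norm_def by (rule onorm_le_matrix_component_sum)

lemma threshold_eq: "0 < N \<Longrightarrow> threshold \<rho> S N = sqrt ((1 + \<rho>) * S) * sqrt (real N * ln (real N)) / real N"
proof -
  assume "0 < N"
  then have "(1 + \<rho>) * S * ln (real N) / real N = ((1 + \<rho>) * S) * (real N * ln (real N)) / (real N)\<^sup>2"
    by (simp add: power2_eq_square)
  then show ?thesis
    unfolding threshold_def by (simp only: real_sqrt_divide real_sqrt_mult[of "(1 + \<rho>) * S"] real_sqrt_abs)
qed

text \<open>The entries of the average are of smaller order than \<open>sqrt (ln N / N)\<close>, and the threshold is a fixed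
  positive multiple of that.\<close>
lemma (in prob_space) spec_norm_average_below_threshold:
  fixes X :: "nat \<Rightarrow> 'a \<Rightarrow> real^'n^'m"
  assumes X: "\<And>n i j. bounded_rv (\<lambda>\<omega>. X n \<omega> $ i $ j)"
    and moment: "\<And>i j a n. expectation (\<lambda>\<omega>. (\<Sum>m=a..<a + n. X m \<omega> $ i $ j) ^ 4) \<le> D * (real n)\<^sup>2"
    and pos: "0 < S" "0 < \<rho>"
  shows "AE \<omega> in M. \<forall>\<^sub>F N in sequentially.
           spec_norm ((1 / real N) *\<^sub>R (\<Sum>n<N. X n \<omega>)) < threshold \<rho> S N"
proof -
  have "AE \<omega> in M. \<forall>\<epsilon>>0. \<forall>\<^sub>F N in sequentially.
           \<bar>\<Sum>n<N. X n \<omega> $ i $ j\<bar> \<le> \<epsilon> * sqrt (real N * ln (real N))" for i j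
    using X moment by (rule partial_sums_small)
  then have "AE \<omega> in M. \<forall>i j. \<forall>\<epsilon>>0. \<forall>\<^sub>F N in sequentially.
           \<bar>\<Sum>n<N. X n \<omega> $ i $ j\<bar> \<le> \<epsilon> * sqrt (real N * ln (real N))"
    by (simp only: AE_finite_all[OF finite_class.finite_UNIV, simplified] simp_thms)
  then show ?thesis
  proof eventually_elim
    case (elim \<omega>)
    \<comment> \<open>makes the entries add up to half of the threshold, which leaves the strict inequality\<close>
    define \<epsilon> where "\<epsilon> = sqrt ((1 + \<rho>) * S) / (2 * real CARD('m) * real CARD('n))"
    have \<epsilon>: "0 < \<epsilon>" using pos by (simp add: \<epsilon>_def)
    have "\<forall>\<^sub>F N in sequentially. \<forall>i j. \<bar>\<Sum>n<N. X n \<omega> $ i $ j\<bar> \<le> \<epsilon> * sqrt (real N * ln (real N))"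
      using elim \<epsilon> by (intro eventually_all_finite) blast
    then show ?case
      using eventually_ge_at_top[of 2]
    proof eventually_elim
      case (elim N)
      define r where "r = sqrt (real N * ln (real N))"
      have "spec_norm ((1 / real N) *\<^sub>R (\<Sum>n<N. X n \<omega>))
          \<le> (\<Sum>i\<in>UNIV. \<Sum>j\<in>UNIV. \<bar>((1 / real N) *\<^sub>R (\<Sum>n<N. X n \<omega>)) $ i $ j\<bar>)"
        by (rule spec_norm_le_entries)
      also have "\<dots> \<le> (\<Sum>i\<in>(UNIV::'m set). \<Sum>j\<in>(UNIV::'n set). (\<epsilon> * r) / real N)"
        using elim by (intro sum_mono) (simp add: abs_mult r_def divide_right_mono)
      also have "\<dots> = (1 / 2) * threshold \<rho> S N"
        using elim(2) by (simp add: threshold_eq \<epsilon>_def r_def)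
      also have "\<dots> < threshold \<rho> S N"
      proof -
        have "0 < threshold \<rho> S N"
          using elim(2) pos by (simp add: threshold_def)
        then show ?thesis by simp
      qed
      finally show ?case .
    qed
  qed
qed

section \<open>Linear filters driven by independent noises\<close>

definition preimages :: "'a measure \<Rightarrow> ('i \<Rightarrow> 'a \<Rightarrow> 'b::topological_space) \<Rightarrow> 'i \<Rightarrow> 'a set set" where
  "preimages M X i = {X i -` A \<inter> space M | A. A \<in> sets borel}"

lemma Int_stable_preimages:
  fixes X :: "'i \<Rightarrow> 'a \<Rightarrow> 'b::topological_space"
  shows "Int_stable (preimages M X i)"
  unfolding Int_stable_def preimages_def
proof safe
  fix A B :: "'b set" assume "A \<in> sets borel" "B \<in> sets borel"
  then show "\<exists>C. X i -` A \<inter> space M \<inter> (X i -` B \<inter> space M) = X i -` C \<inter> space M \<and> C \<in> sets borel"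
    by (intro exI[of _ "A \<inter> B"]) auto
qed

lemma preimages_image:
  fixes X :: "'i \<Rightarrow> 'a \<Rightarrow> 'b::topological_space" and Y :: "'i \<Rightarrow> 'a \<Rightarrow> 'c::topological_space"
  assumes "f \<in> borel_measurable borel" "\<And>\<omega>. X i \<omega> = f (Y i \<omega>)"
  shows "preimages M X i \<subseteq> preimages M Y i"
  unfolding preimages_def
proof safe
  fix A :: "'b set" assume "A \<in> sets borel"
  then have "f -` A \<in> sets borel"
    using measurable_sets_borel[OF assms(1)] by simp
  then show "\<exists>B. X i -` A \<inter> space M = Y i -` B \<inter> space M \<and> B \<in> sets borel"
    by (intro exI[of _ "f -` A"]) (auto simp: assms(2))
qed

lemma generated_events_eq: "generated_events M X I = sigma_sets (space M) (\<Union>i\<in>I. preimages M X i)"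
  by (simp add: generated_events_def preimages_def)

lemma (in prob_space) indep_sets_preimages: "iid X I \<Longrightarrow> indep_sets (preimages M X) I"
  unfolding iid_def indep_vars_def2 preimages_def by simp

text \<open>Both \<open>w\<close> and \<open>\<zeta>\<close> are continuous images of the joint processes, so their events inherit the
  independence that is assumed for the joint ones.\<close>
lemma (in prob_space) independent_sources_noises:
  fixes w :: "'i \<Rightarrow> 'a \<Rightarrow> 'b::second_countable_topology" and \<zeta> \<eta> :: "'i \<Rightarrow> 'a \<Rightarrow> 'c::second_countable_topology"
    and e :: "'j \<Rightarrow> 'a \<Rightarrow> 'd::second_countable_topology"
  assumes "iid w UNIV" "iid \<zeta> UNIV" "iid e I"
    and w_indep: "indep_processes w UNIV (\<lambda>n \<omega>. (\<zeta> n \<omega>, \<eta> n \<omega>)) UNIV"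
    and e_indep: "indep_processes e I (\<lambda>n \<omega>. (w n \<omega>, \<zeta> n \<omega>, \<eta> n \<omega>)) UNIV"
  shows "independent_sources M (case_sum (case_sum (preimages M w) (preimages M \<zeta>)) (preimages M e))
           ((UNIV <+> UNIV) <+> I)"
proof
  have \<zeta>_sub: "preimages M \<zeta> n \<subseteq> preimages M (\<lambda>n \<omega>. (\<zeta> n \<omega>, \<eta> n \<omega>)) n" for n
    by (rule preimages_image[where f = fst]) (auto intro!: borel_measurable_continuous_onI continuous_intros)
  have w_sub': "preimages M w n \<subseteq> preimages M (\<lambda>n \<omega>. (w n \<omega>, \<zeta> n \<omega>, \<eta> n \<omega>)) n" for n
    by (rule preimages_image[where f = fst]) (auto intro!: borel_measurable_continuous_onI continuous_intros)
  have \<zeta>_sub': "preimages M \<zeta> n \<subseteq> preimages M (\<lambda>n \<omega>. (w n \<omega>, \<zeta> n \<omega>, \<eta> n \<omega>)) n" for n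
    by (rule preimages_image[where f = "\<lambda>x. fst (snd x)"])
       (auto intro!: borel_measurable_continuous_onI continuous_intros)
  have w\<zeta>: "indep_sets (case_sum (preimages M w) (preimages M \<zeta>)) (UNIV <+> UNIV)"
  proof (rule indep_sets_Plus)
    show "indep_set (sigma_sets (space M) (\<Union> (range (preimages M w))))
        (sigma_sets (space M) (\<Union> (range (preimages M \<zeta>))))"
      using w_indep unfolding indep_processes_def generated_events_eq indep_set_def
    proof (rule indep_sets_mono_sets)
      have "sigma_sets (space M) (\<Union> (range (preimages M \<zeta>)))
          \<subseteq> sigma_sets (space M) (\<Union> (range (preimages M (\<lambda>n \<omega>. (\<zeta> n \<omega>, \<eta> n \<omega>)))))"
        using \<zeta>_sub by (intro sigma_sets_mono') blast
      then show "(case b of True \<Rightarrow> sigma_sets (space M) (\<Union> (range (preimages M w)))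
            | False \<Rightarrow> sigma_sets (space M) (\<Union> (range (preimages M \<zeta>))))
          \<subseteq> (case b of True \<Rightarrow> sigma_sets (space M) (\<Union> (range (preimages M w)))
            | False \<Rightarrow> sigma_sets (space M) (\<Union> (range (preimages M (\<lambda>n \<omega>. (\<zeta> n \<omega>, \<eta> n \<omega>))))))" for b
        by (cases b) simp_all
    qed
  qed (use assms in \<open>simp_all add: indep_sets_preimages\<close>)
  show "indep_sets (case_sum (case_sum (preimages M w) (preimages M \<zeta>)) (preimages M e)) ((UNIV <+> UNIV) <+> I)"
  proof (rule indep_sets_Plus[OF w\<zeta> indep_sets_preimages[OF assms(3)]], rule indep_setI)
    define W where "W = sigma_sets (space M) (\<Union>i\<in>UNIV <+> UNIV. case_sum (preimages M w) (preimages M \<zeta>) i)"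
    define Z where "Z = generated_events M (\<lambda>n \<omega>. (w n \<omega>, \<zeta> n \<omega>, \<eta> n \<omega>)) UNIV"
    have ind: "indep_set (generated_events M e I) Z"
      using e_indep by (simp add: indep_processes_def Z_def)
    have "(\<Union>i\<in>UNIV <+> UNIV. case_sum (preimages M w) (preimages M \<zeta>) i)
        \<subseteq> (\<Union>n. preimages M (\<lambda>n \<omega>. (w n \<omega>, \<zeta> n \<omega>, \<eta> n \<omega>)) n)"
    proof (rule UN_least)
      fix i :: "'i + 'i"
      show "case_sum (preimages M w) (preimages M \<zeta>) i \<subseteq> (\<Union>n. preimages M (\<lambda>n \<omega>. (w n \<omega>, \<zeta> n \<omega>, \<eta> n \<omega>)) n)"
        using w_sub' \<zeta>_sub' by (cases i) (simp_all, blast+)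
    qed
    then have sub: "W \<subseteq> Z"
      unfolding W_def Z_def generated_events_eq by (rule sigma_sets_mono')
    show "W \<subseteq> events"
      using sub indep_setD_ev2[OF ind] by (rule order_trans)
    show "sigma_sets (space M) (\<Union> (preimages M e ` I)) \<subseteq> events"
      using indep_setD_ev1[OF ind] by (simp only: generated_events_eq)
    fix a b
    assume "a \<in> W" "b \<in> sigma_sets (space M) (\<Union> (preimages M e ` I))"
    then have "prob (b \<inter> a) = prob b * prob a"
      using sub by (intro indep_setD[OF ind]) (auto simp: generated_events_eq)
    then show "prob (a \<inter> b) = prob a * prob b"
      by (simp add: Int_commute mult.commute)
  qed
  fix i :: "('i + 'i) + 'j"
  show "Int_stable (case_sum (case_sum (preimages M w) (preimages M \<zeta>)) (preimages M e) i)"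
    by (cases i rule: sum.exhaust[case_product]) (auto split: sum.split simp: Int_stable_preimages)
qed

text \<open>Reduces measurability and integrability of random matrices to their entries.\<close>
lemma matrix_unit_expansion:
  fixes X :: "real^'m^'n"
  shows "X = (\<Sum>i\<in>UNIV. \<Sum>j\<in>UNIV. X $ i $ j *\<^sub>R axis i (axis j 1))"
proof -
  have unit: "(axis i (axis j 1) :: real^'m^'n) $ i' $ j' = (if i = i' then if j = j' then 1 else 0 else 0)"
    for i i' :: 'n and j j' :: 'm
    by (simp add: axis_def)
  have delta: "(\<Sum>i\<in>UNIV. \<Sum>j\<in>UNIV. X $ i $ j * (if i = i' then if j = j' then 1 else 0 else 0)) = X $ i' $ j'"
    for i' j'
  proof -
    have "(\<Sum>j\<in>UNIV. X $ i $ j * (if i = i' then if j = j' then 1 else 0 else 0))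
        = (\<Sum>j\<in>UNIV. if j = j' then if i = i' then X $ i $ j' else 0 else 0)" for i
      by (intro sum.cong) auto
    then show ?thesis by simp
  qed
  show ?thesis
    by (simp add: vec_eq_iff unit delta)
qed

lemma integrable_outer:
  fixes x :: "'a \<Rightarrow> real^'n" and y :: "'a \<Rightarrow> real^'m"
  assumes "\<And>i j. integrable M (\<lambda>\<omega>. x \<omega> $ i * y \<omega> $ j)"
  shows "integrable M (\<lambda>\<omega>. outer (x \<omega>) (y \<omega>))"
proof -
  have "outer (x \<omega>) (y \<omega>) = (\<Sum>i\<in>UNIV. \<Sum>j\<in>UNIV. (x \<omega> $ i * y \<omega> $ j) *\<^sub>R axis i (axis j 1))" for \<omega>
    using matrix_unit_expansion[of "outer (x \<omega>) (y \<omega>)"] by (simp add: outer_def)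
  then show ?thesis
    using assms by (simp add: Bochner_Integration.integrable_sum)
qed

lemma (in prob_space) bounded_rv_vec_nth:
  fixes x :: "'a \<Rightarrow> real^'n"
  assumes "x \<in> borel_measurable M" "AE \<omega> in M. norm (x \<omega>) \<le> c"
  shows "bounded_rv (\<lambda>\<omega>. x \<omega> $ i)"
proof (rule bounded_rvI[where c = c])
  show "(\<lambda>\<omega>. x \<omega> $ i) \<in> borel_measurable M"
    using borel_measurable_continuous_on[OF linear_continuous_on[OF bounded_linear_vec_nth] assms(1)] .
  show "AE \<omega> in M. \<bar>x \<omega> $ i\<bar> \<le> c"
    using assms(2)
  proof eventually_elim
    case (elim \<omega>)
    then show ?case using component_le_norm_cart[of "x \<omega>" i] by linarith
  qed
qed

lemma (in prob_space) bound_nonneg: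
  assumes "AE \<omega> in M. norm (x \<omega>) \<le> c"
  shows "0 \<le> c"
proof -
  have "AE \<omega> in M. 0 \<le> c"
    using assms by eventually_elim (rule order_trans[OF norm_ge_zero])
  then show ?thesis by simp
qed

lemma (in prob_space) expectation_vec_nth:
  fixes x :: "'a \<Rightarrow> real^'n"
  assumes "x \<in> borel_measurable M" "AE \<omega> in M. norm (x \<omega>) \<le> c"
  shows "expectation (\<lambda>\<omega>. x \<omega> $ i) = (\<integral>\<omega>. x \<omega> \<partial>M) $ i"
  by (rule integral_bounded_linear[OF bounded_linear_vec_nth])
     (rule integrable_const_bound[OF assms(2,1)])

lemma (in prob_space) expectation_mult_vec_nth:
  fixes x :: "'a \<Rightarrow> real^'n"
  assumes "x \<in> borel_measurable M" "AE \<omega> in M. norm (x \<omega>) \<le> c" "(\<integral>\<omega>. x \<omega> \<partial>M) = 0"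
  shows "expectation (\<lambda>\<omega>. x \<omega> $ i * x \<omega> $ j) = covariance_matrix M x $ i $ j"
proof -
  have "bounded_linear (\<lambda>X::real^'n^'n. X $ i $ j)"
    using bounded_linear_compose[OF bounded_linear_vec_nth bounded_linear_vec_nth] .
  moreover have "integrable M (\<lambda>\<omega>. outer (x \<omega>) (x \<omega>))"
    by (intro integrable_outer integrable_bounded_rv bounded_rv_mult bounded_rv_vec_nth[OF assms(1,2)])
  ultimately have "expectation (\<lambda>\<omega>. outer (x \<omega>) (x \<omega>) $ i $ j) = (\<integral>\<omega>. outer (x \<omega>) (x \<omega>) \<partial>M) $ i $ j"
    by (rule integral_bounded_linear)
  then show ?thesis
    by (simp add: covariance_matrix_def assms(3) outer_def)
qed

text \<open>The bilinear form in which second moments of \<open>X *v w\<close> appear when \<open>Q\<close> is the covariance matrix of \<open>w\<close>.\<close>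
lemma congruence_entry:
  fixes X :: "real^'n^'m" and Q :: "real^'n^'n"
  shows "(X ** Q ** transpose X) $ i $ j = (\<Sum>a\<in>UNIV. \<Sum>b\<in>UNIV. X $ i $ a * X $ j $ b * Q $ a $ b)"
  unfolding matrix_matrix_mult_def transpose_def
  by (subst sum.swap) (simp add: sum_distrib_left sum_distrib_right mult_ac)

text \<open>The sources \<open>Inl (Inl k)\<close>, \<open>Inl (Inr k)\<close> and \<open>Inr k\<close> are \<open>w k\<close>, \<open>\<zeta> k\<close> and \<open>e k\<close>.\<close>
locale noise = independent_sources M
    "case_sum (case_sum (preimages M w) (preimages M \<zeta>)) (preimages M e)" "(UNIV <+> UNIV) <+> I"
  for M :: "'a measure" and w :: "nat \<Rightarrow> 'a \<Rightarrow> real^'p" and \<zeta> :: "nat \<Rightarrow> 'a \<Rightarrow> real^'m"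
    and e :: "int \<Rightarrow> 'a \<Rightarrow> real^'q" and I :: "int set" +
  fixes Kw Kz Ke :: real and \<Sigma>w :: "real^'p^'p" and \<Sigma>z :: "real^'m^'m"
  assumes w_bound: "\<And>k. AE \<omega> in M. norm (w k \<omega>) \<le> Kw"
    and z_bound: "\<And>k. AE \<omega> in M. norm (\<zeta> k \<omega>) \<le> Kz"
    and e_bound: "\<And>k. k \<in> I \<Longrightarrow> AE \<omega> in M. norm (e k \<omega>) \<le> Ke"
    and w_mean: "\<And>k. (\<integral>\<omega>. w k \<omega> \<partial>M) = 0"
    and z_mean: "\<And>k. (\<integral>\<omega>. \<zeta> k \<omega> \<partial>M) = 0"
    and e_mean: "\<And>k. k \<in> I \<Longrightarrow> (\<integral>\<omega>. e k \<omega> \<partial>M) = 0"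
    and w_cov: "\<And>k. covariance_matrix M (w k) = \<Sigma>w"
    and z_cov: "\<And>k. covariance_matrix M (\<zeta> k) = \<Sigma>z"
begin

definition noise_at :: "nat \<Rightarrow> ((nat + nat) + int) set" where
  "noise_at k = {Inl (Inl k), Inl (Inr k)}"

lemma noise_at_subset: "noise_at k \<subseteq> (UNIV <+> UNIV) <+> I"
  by (auto simp: noise_at_def)

lemma disjoint_noise_at: "disjoint_family noise_at"
  by (auto simp: noise_at_def disjoint_family_on_def)

lemma info_measurable:
  fixes X :: "'i \<Rightarrow> 'a \<Rightarrow> 'b::topological_space"
  assumes "J \<subseteq> (UNIV <+> UNIV) <+> I" "s \<in> J"
    and "case_sum (case_sum (preimages M w) (preimages M \<zeta>)) (preimages M e) s = preimages M X k"
  shows "X k \<in> borel_measurable (info J)"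
proof (rule measurableI)
  fix A :: "'b set" assume "A \<in> sets borel"
  then have "X k -` A \<inter> space M \<in> preimages M X k"
    by (auto simp: preimages_def)
  then show "X k -` A \<inter> space (info J) \<in> sets (info J)"
    using assms(2,3) unfolding sets_info[OF assms(1)] space_info
    by (intro sigma_sets.Basic) blast
qed simp

lemma w_info: "w k \<in> borel_measurable (info {Inl (Inl k)})"
  by (rule info_measurable) auto

lemma z_info: "\<zeta> k \<in> borel_measurable (info {Inl (Inr k)})"
  by (rule info_measurable) auto

lemma e_info: "k \<in> I \<Longrightarrow> e k \<in> borel_measurable (info {Inr k})"
  by (rule info_measurable) auto

lemma w_rv: "w k \<in> borel_measurable M"
  by (rule measurable_info[OF _ w_info]) auto

lemma z_rv: "\<zeta> k \<in> borel_measurable M"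
  by (rule measurable_info[OF _ z_info]) auto

lemma e_rv: "k \<in> I \<Longrightarrow> e k \<in> borel_measurable M"
  by (rule measurable_info[OF _ e_info]) auto

lemmas bounded_w = bounded_rv_vec_nth[OF w_rv w_bound]
  and bounded_z = bounded_rv_vec_nth[OF z_rv z_bound]

text \<open>What the two noises of time \<open>k\<close> add to the output of a linear filter with gains \<open>X\<close> and \<open>Y\<close>.\<close>
definition response :: "real^'p^'m \<Rightarrow> real^'m^'m \<Rightarrow> nat \<Rightarrow> 'a \<Rightarrow> real^'m" where
  "response X Y k \<omega> = X *v w k \<omega> + Y *v \<zeta> k \<omega>"

lemma response_nth:
  "response X Y k \<omega> $ i = (\<Sum>a\<in>UNIV. X $ i $ a * w k \<omega> $ a) + (\<Sum>a\<in>UNIV. Y $ i $ a * \<zeta> k \<omega> $ a)"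
  by (simp add: response_def matrix_vector_mult_def)

lemma nth_measurable:
  fixes x :: "'a \<Rightarrow> real^'n"
  shows "x \<in> borel_measurable N \<Longrightarrow> (\<lambda>\<omega>. x \<omega> $ i) \<in> borel_measurable N"
  using borel_measurable_continuous_on[OF linear_continuous_on[OF bounded_linear_vec_nth]] .

lemma response_info: "(\<lambda>\<omega>. response X Y k \<omega> $ i) \<in> borel_measurable (info (noise_at k))"
proof -
  have "w k \<in> borel_measurable (info (noise_at k))"
    by (rule measurable_info_mono[OF _ noise_at_subset w_info]) (simp add: noise_at_def)
  moreover have "\<zeta> k \<in> borel_measurable (info (noise_at k))"
    by (rule measurable_info_mono[OF _ noise_at_subset z_info]) (simp add: noise_at_def)
  ultimately show ?thesis
    unfolding response_nth
    by (intro borel_measurable_add borel_measurable_sum borel_measurable_times borel_measurable_const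
        nth_measurable)
qed

lemma response_bound:
  "AE \<omega> in M. \<bar>response X Y k \<omega> $ i\<bar> \<le> spec_norm X * Kw + spec_norm Y * Kz"
  using w_bound[of k] z_bound[of k]
proof eventually_elim
  case (elim \<omega>)
  have "\<bar>response X Y k \<omega> $ i\<bar> \<le> norm (response X Y k \<omega>)"
    by (rule component_le_norm_cart)
  also have "\<dots> \<le> norm (X *v w k \<omega>) + norm (Y *v \<zeta> k \<omega>)"
    unfolding response_def by (rule norm_triangle_ineq)
  also have "\<dots> \<le> spec_norm X * norm (w k \<omega>) + spec_norm Y * norm (\<zeta> k \<omega>)"
    by (intro add_mono norm_mult_vec_le_spec_norm)
  also have "\<dots> \<le> spec_norm X * Kw + spec_norm Y * Kz"
    using elim by (intro add_mono mult_left_mono spec_norm_nonneg)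
  finally show ?case .
qed

lemma bounded_response: "bounded_rv (\<lambda>\<omega>. response X Y k \<omega> $ i)"
  using measurable_info[OF noise_at_subset response_info] response_bound by (rule bounded_rvI)

lemma response_mean: "expectation (\<lambda>\<omega>. response X Y k \<omega> $ i) = 0"
proof -
  have "expectation (\<lambda>\<omega>. response X Y k \<omega> $ i)
      = (\<Sum>a\<in>UNIV. X $ i $ a * expectation (\<lambda>\<omega>. w k \<omega> $ a)) + (\<Sum>a\<in>UNIV. Y $ i $ a * expectation (\<lambda>\<omega>. \<zeta> k \<omega> $ a))"
    unfolding response_nth
    by (simp add: Bochner_Integration.integral_add Bochner_Integration.integral_sum
        Bochner_Integration.integrable_sum integrable_bounded_rv[OF bounded_w] integrable_bounded_rv[OF bounded_z])
  then show ?thesis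
    by (simp add: expectation_vec_nth[OF w_rv w_bound] expectation_vec_nth[OF z_rv z_bound] w_mean z_mean)
qed

lemma expectation_w_mult_z: "expectation (\<lambda>\<omega>. w k \<omega> $ a * \<zeta> k \<omega> $ b) = 0"
proof (rule expectation_mult_centred[OF _ _ _ nth_measurable[OF w_info] bounded_w
      nth_measurable[OF z_info] bounded_z])
  show "expectation (\<lambda>\<omega>. \<zeta> k \<omega> $ b) = 0"
    by (simp add: expectation_vec_nth[OF z_rv z_bound] z_mean)
qed auto

lemma response_second_moment:
  "expectation (\<lambda>\<omega>. response X Y k \<omega> $ i * response X Y k \<omega> $ j)
    = (X ** \<Sigma>w ** transpose X + Y ** \<Sigma>z ** transpose Y) $ i $ j"
proof -
  note [simp] = integrable_bounded_rv[OF bounded_rv_mult[OF bounded_w bounded_w]]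
    integrable_bounded_rv[OF bounded_rv_mult[OF bounded_w bounded_z]]
    integrable_bounded_rv[OF bounded_rv_mult[OF bounded_z bounded_z]]
  have "response X Y k \<omega> $ i * response X Y k \<omega> $ j
      = (\<Sum>a\<in>UNIV. \<Sum>b\<in>UNIV. X $ i $ a * X $ j $ b * (w k \<omega> $ a * w k \<omega> $ b))
      + (\<Sum>a\<in>UNIV. \<Sum>b\<in>UNIV. X $ i $ a * Y $ j $ b * (w k \<omega> $ a * \<zeta> k \<omega> $ b))
      + (\<Sum>a\<in>UNIV. \<Sum>b\<in>UNIV. X $ j $ a * Y $ i $ b * (w k \<omega> $ a * \<zeta> k \<omega> $ b))
      + (\<Sum>a\<in>UNIV. \<Sum>b\<in>UNIV. Y $ i $ a * Y $ j $ b * (\<zeta> k \<omega> $ a * \<zeta> k \<omega> $ b))" for \<omega>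
  proof -
    have prod: "(\<Sum>a\<in>(UNIV::'c::finite set). f a * x a) * (\<Sum>b\<in>(UNIV::'d::finite set). g b * y b)
        = (\<Sum>a\<in>UNIV. \<Sum>b\<in>UNIV. f a * g b * (x a * y b))" for f x :: "'c::finite \<Rightarrow> real" and g y :: "'d::finite \<Rightarrow> real"
      by (simp add: sum_product mult_ac)
    have expand: "(x + y) * (x' + y') = x * x' + x * y' + x' * y + y * y'" for x x' y y' :: real
      by algebra
    show ?thesis
      unfolding response_nth expand prod ..
  qed
  then have "expectation (\<lambda>\<omega>. response X Y k \<omega> $ i * response X Y k \<omega> $ j)
      = (\<Sum>a\<in>UNIV. \<Sum>b\<in>UNIV. X $ i $ a * X $ j $ b * expectation (\<lambda>\<omega>. w k \<omega> $ a * w k \<omega> $ b))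
      + (\<Sum>a\<in>UNIV. \<Sum>b\<in>UNIV. X $ i $ a * Y $ j $ b * expectation (\<lambda>\<omega>. w k \<omega> $ a * \<zeta> k \<omega> $ b))
      + (\<Sum>a\<in>UNIV. \<Sum>b\<in>UNIV. X $ j $ a * Y $ i $ b * expectation (\<lambda>\<omega>. w k \<omega> $ a * \<zeta> k \<omega> $ b))
      + (\<Sum>a\<in>UNIV. \<Sum>b\<in>UNIV. Y $ i $ a * Y $ j $ b * expectation (\<lambda>\<omega>. \<zeta> k \<omega> $ a * \<zeta> k \<omega> $ b))"
    by (simp add: Bochner_Integration.integral_add Bochner_Integration.integral_sum
        Bochner_Integration.integrable_sum)
  then show ?thesis
    by (simp add: expectation_w_mult_z congruence_entry expectation_mult_vec_nth[OF w_rv w_bound w_mean]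
        expectation_mult_vec_nth[OF z_rv z_bound z_mean] w_cov z_cov)
qed

lemma response_uncorrelated:
  assumes "k \<noteq> k'"
  shows "expectation (\<lambda>\<omega>. response X Y k \<omega> $ i * response X' Y' k' \<omega> $ j) = 0"
  by (rule expectation_mult_centred[OF noise_at_subset noise_at_subset _ response_info bounded_response
        response_info bounded_response response_mean])
     (use assms in \<open>simp add: noise_at_def\<close>)

text \<open>The output \<open>d\<close> of a causal linear filter whose total gain, weighted with the noise bounds, is at most
  \<open>\<kappa>\<close>. The identity is required on \<open>space M\<close> only, since the residual is specified only there.\<close>
context
  fixes G :: "nat \<Rightarrow> real^'p^'m" and H :: "nat \<Rightarrow> real^'m^'m" and d :: "nat \<Rightarrow> 'a \<Rightarrow> real^'m" and \<kappa> :: real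
  assumes d_eq: "\<And>n \<omega>. \<omega> \<in> space M \<Longrightarrow> d n \<omega> = (\<Sum>l\<le>n. response (G l) (H l) (n - l) \<omega>)"
    and gain: "\<And>n. (\<Sum>l\<le>n. spec_norm (G l) * Kw + spec_norm (H l) * Kz) \<le> \<kappa>"
begin

lemma filter_nth: "\<omega> \<in> space M \<Longrightarrow> d n \<omega> $ i = (\<Sum>l\<le>n. response (G l) (H l) (n - l) \<omega> $ i)"
  by (simp add: d_eq)

lemma filter_product:
  "\<omega> \<in> space M \<Longrightarrow> d n \<omega> $ i * d n \<omega> $ j
    = (\<Sum>l\<le>n. response (G l) (H l) (n - l) \<omega> $ i) * (\<Sum>l\<le>n. response (G l) (H l) (n - l) \<omega> $ j)"
  by (simp only: filter_nth)

text \<open>Responses to noises of different times are uncorrelated, so only equal lags contribute.\<close>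
lemma expectation_filter_product:
  "expectation (\<lambda>\<omega>. d n \<omega> $ i * d n \<omega> $ j)
    = (\<Sum>l\<le>n. G l ** \<Sigma>w ** transpose (G l) + H l ** \<Sigma>z ** transpose (H l)) $ i $ j"
proof -
  define r where "r l i \<omega> = response (G l) (H l) (n - l) \<omega> $ i" for l i \<omega>
  have r: "bounded_rv (r l i)" for l i
    unfolding r_def by (rule bounded_response)
  have "expectation (\<lambda>\<omega>. d n \<omega> $ i * d n \<omega> $ j)
      = expectation (\<lambda>\<omega>. \<Sum>l\<le>n. \<Sum>l'\<le>n. r l i \<omega> * r l' j \<omega>)"
    by (intro Bochner_Integration.integral_cong refl) (simp only: filter_product sum_product r_def)
  also have "\<dots> = (\<Sum>l\<le>n. \<Sum>l'\<le>n. expectation (\<lambda>\<omega>. r l i \<omega> * r l' j \<omega>))"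
    by (simp add: Bochner_Integration.integral_sum Bochner_Integration.integrable_sum
        integrable_bounded_rv[OF bounded_rv_mult[OF r r]])
  also have "\<dots> = (\<Sum>l\<le>n. \<Sum>l'\<le>n. if l = l' then (G l ** \<Sigma>w ** transpose (G l) + H l ** \<Sigma>z ** transpose (H l)) $ i $ j else 0)"
  proof (intro sum.cong refl)
    fix l l' assume "l \<in> {..n}" "l' \<in> {..n}"
    then show "expectation (\<lambda>\<omega>. r l i \<omega> * r l' j \<omega>)
        = (if l = l' then (G l ** \<Sigma>w ** transpose (G l) + H l ** \<Sigma>z ** transpose (H l)) $ i $ j else 0)"
    proof (cases "l = l'")
      case True
      then show ?thesis
        unfolding r_def by (simp add: response_second_moment)
    next
      case False
      then have "n - l \<noteq> n - l'" using \<open>l \<in> {..n}\<close> \<open>l' \<in> {..n}\<close> by auto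
      then show ?thesis
        unfolding r_def using False by (simp add: response_uncorrelated)
    qed
  qed
  also have "\<dots> = (\<Sum>l\<le>n. G l ** \<Sigma>w ** transpose (G l) + H l ** \<Sigma>z ** transpose (H l)) $ i $ j"
    by simp
  finally show ?thesis .
qed

lemma bounded_filter: "bounded_rv (\<lambda>\<omega>. d n \<omega> $ i)"
proof -
  have *: "bounded_rv (\<lambda>\<omega>. \<Sum>l\<le>n. response (G l) (H l) (n - l) \<omega> $ i)"
    by (intro bounded_rv_sum bounded_response)
  then obtain c where "AE \<omega> in M. \<bar>\<Sum>l\<le>n. response (G l) (H l) (n - l) \<omega> $ i\<bar> \<le> c"
    by (auto simp: bounded_rv_def)
  then have "AE \<omega> in M. \<bar>d n \<omega> $ i\<bar> \<le> c"
    using AE_space by eventually_elim (simp only: filter_nth)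
  moreover have "(\<lambda>\<omega>. d n \<omega> $ i) \<in> borel_measurable M"
    using bounded_rv_measurable[OF *] by (subst measurable_cong[OF filter_nth])
  ultimately show ?thesis by (intro bounded_rvI)
qed

lemma filter_bound: "AE \<omega> in M. \<bar>d n \<omega> $ i\<bar> \<le> \<kappa>"
proof -
  have "AE \<omega> in M. \<forall>l. \<bar>response (G l) (H l) (n - l) \<omega> $ i\<bar> \<le> spec_norm (G l) * Kw + spec_norm (H l) * Kz"
    using response_bound by (simp add: AE_all_countable)
  then show ?thesis
    using AE_space
  proof eventually_elim
    case (elim \<omega>)
    have "\<bar>d n \<omega> $ i\<bar> \<le> (\<Sum>l\<le>n. \<bar>response (G l) (H l) (n - l) \<omega> $ i\<bar>)"
      unfolding filter_nth[OF elim(2)] by (rule sum_abs)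
    also have "\<dots> \<le> (\<Sum>l\<le>n. spec_norm (G l) * Kw + spec_norm (H l) * Kz)"
      using elim(1) by (intro sum_mono) blast
    also note gain[of n]
    finally show ?case .
  qed
qed

lemma fourth_moment_filter_covariance:
  "expectation (\<lambda>\<omega>. (\<Sum>m=c..<c + n. d m \<omega> $ i * d m \<omega> $ j - expectation (\<lambda>\<omega>. d m \<omega> $ i * d m \<omega> $ j)) ^ 4)
    \<le> 64 * (\<kappa> + 2) ^ 8 * (real n)\<^sup>2"
proof -
  \<comment> \<open>\<open>2\<^sup>-\<^sup>l\<close> makes the majorant of the gains strictly positive and adds at most \<open>2\<close> to its sum\<close>
  define h where "h l = spec_norm (G l) * Kw + spec_norm (H l) * Kz + (1/2) ^ l" for l
  have Kw: "0 \<le> Kw" and Kz: "0 \<le> Kz"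
    using bound_nonneg[OF w_bound] bound_nonneg[OF z_bound] .
  have geo: "(\<Sum>l\<le>n. (1/2::real) ^ l) \<le> 2" for n
  proof -
    have "(\<Sum>l\<le>n. (1/2::real) ^ l) = 2 - (1/2) ^ n"
      by (induction n) auto
    then show ?thesis by simp
  qed
  have h: "0 < h l" for l
    unfolding h_def using Kw Kz by (intro add_nonneg_pos add_nonneg_nonneg mult_nonneg_nonneg spec_norm_nonneg) simp_all
  have sum_h: "(\<Sum>l\<le>n. h l) \<le> \<kappa> + 2" for n
    unfolding h_def sum.distrib[of _ "\<lambda>l. (1/2) ^ l"] using gain[of n] geo[of n] by (rule add_mono)
  have bound: "AE \<omega> in M. \<bar>response (G l) (H l) k \<omega> $ i\<bar> \<le> h l" for l k i
    using response_bound[of "G l" "H l" k i]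
  proof eventually_elim
    case (elim \<omega>)
    then show ?case unfolding h_def by (rule order_trans) simp
  qed
  have eq: "expectation (\<lambda>\<omega>. (\<Sum>l\<le>m. response (G l) (H l) (m - l) \<omega> $ i) * (\<Sum>l\<le>m. response (G l) (H l) (m - l) \<omega> $ j))
      = expectation (\<lambda>\<omega>. d m \<omega> $ i * d m \<omega> $ j)" for m
    by (intro Bochner_Integration.integral_cong refl) (simp only: filter_product)
  have "expectation (\<lambda>\<omega>. (\<Sum>m=c..<c + n. d m \<omega> $ i * d m \<omega> $ j - expectation (\<lambda>\<omega>. d m \<omega> $ i * d m \<omega> $ j)) ^ 4)
      = expectation (\<lambda>\<omega>. (\<Sum>m=c..<c + n.
          (\<Sum>l\<le>m. response (G l) (H l) (m - l) \<omega> $ i) * (\<Sum>l\<le>m. response (G l) (H l) (m - l) \<omega> $ j)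
          - expectation (\<lambda>\<omega>. (\<Sum>l\<le>m. response (G l) (H l) (m - l) \<omega> $ i)
              * (\<Sum>l\<le>m. response (G l) (H l) (m - l) \<omega> $ j))) ^ 4)"
    by (intro Bochner_Integration.integral_cong refl) (simp only: filter_product eq)
  also have "\<dots> \<le> 64 * (\<kappa> + 2) ^ 8 * (real n)\<^sup>2"
    by (rule fourth_moment_product_moving_averages[where h = h and blk = noise_at
          and a = "\<lambda>l k \<omega>. response (G l) (H l) k \<omega> $ i" and b = "\<lambda>l k \<omega>. response (G l) (H l) k \<omega> $ j",
          OF noise_at_subset disjoint_noise_at response_info response_info bound bound response_mean response_mean h sum_h])
  finally show ?thesis .
qed

text \<open>The filter output is a function of the noises alone and the watermark is independent of them.\<close>
lemma fourth_moment_filter_watermark: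
  fixes s :: "nat \<Rightarrow> int"
  assumes s: "range s \<subseteq> I" "inj s"
  shows "expectation (\<lambda>\<omega>. (\<Sum>m=c..<c + n. d m \<omega> $ i * e (s m) \<omega> $ j) ^ 4)
    \<le> 4 * (\<kappa> * Ke) ^ 4 * (real n)\<^sup>2"
proof (rule fourth_moment_product_fresh_factor[where ?I0.0 = "(UNIV <+> UNIV) <+> {}" and j = "\<lambda>n. Inr (s n)"])
  have sI: "s n \<in> I" for n using s(1) by auto
  show "(UNIV <+> UNIV) <+> {} \<subseteq> ((UNIV <+> UNIV) <+> I :: ((nat + nat) + int) set)"
    by auto
  show "range (\<lambda>n. Inr (s n)) \<subseteq> (UNIV <+> UNIV) <+> I"
    using sI by auto
  show "inj (\<lambda>n. Inr (s n) :: (nat + nat) + int)"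
    using s(2) by (auto simp: inj_def)
  show "range (\<lambda>n. Inr (s n)) \<inter> ((UNIV <+> UNIV) <+> {}) = {}"
    by auto
  have "(\<lambda>\<omega>. \<Sum>l\<le>n. response (G l) (H l) (n - l) \<omega> $ i) \<in> borel_measurable (info ((UNIV <+> UNIV) <+> {}))" for n
    by (intro borel_measurable_sum measurable_info_mono[OF _ _ response_info]) (auto simp: noise_at_def)
  then show "(\<lambda>\<omega>. d n \<omega> $ i) \<in> borel_measurable (info ((UNIV <+> UNIV) <+> {}))" for n
    by (subst measurable_cong[OF filter_nth]) (simp_all only: space_info)
  show "(\<lambda>\<omega>. e (s n) \<omega> $ j) \<in> borel_measurable (info {Inr (s n)})" for n
    by (intro nth_measurable e_info sI)
  show "AE \<omega> in M. \<bar>d n \<omega> $ i\<bar> \<le> \<kappa>" for n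
    by (rule filter_bound)
  show "AE \<omega> in M. \<bar>e (s n) \<omega> $ j\<bar> \<le> Ke" for n
    using e_bound[OF sI[of n]]
  proof eventually_elim
    case (elim \<omega>)
    then show ?case using component_le_norm_cart[of "e (s n) \<omega>" j] by linarith
  qed
  show "expectation (\<lambda>\<omega>. e (s n) \<omega> $ j) = 0" for n
    using expectation_vec_nth[OF e_rv e_bound] e_mean sI by simp
qed

end

end

section \<open>Measurability of the spectral norm\<close>
lemma spec_norm_triangle: "spec_norm (X + Y) \<le> spec_norm X + spec_norm Y"
  unfolding spec_norm_def matrix_vector_mult_add_rdistrib
  by (intro onorm_triangle matrix_vector_mul_bounded_linear)

lemma continuous_on_spec_norm: "continuous_on UNIV (spec_norm :: real^'n^'m \<Rightarrow> real)"
proof -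
  define c where "c = real CARD('m) * real CARD('n)"
  have le: "spec_norm X \<le> c * norm X" for X :: "real^'n^'m"
  proof -
    have "spec_norm X \<le> (\<Sum>i\<in>UNIV. \<Sum>j\<in>UNIV. \<bar>X $ i $ j\<bar>)"
      by (rule spec_norm_le_entries)
    also have "\<dots> \<le> (\<Sum>i\<in>(UNIV :: 'm set). \<Sum>j\<in>(UNIV :: 'n set). norm X)"
      by (intro sum_mono order_trans[OF component_le_norm_cart Finite_Cartesian_Product.norm_nth_le])
    finally show ?thesis by (simp add: c_def mult_ac)
  qed
  have diff: "spec_norm X - spec_norm Y \<le> c * dist X Y" for X Y :: "real^'n^'m"
    using spec_norm_triangle[of "X - Y" Y] le[of "X - Y"] by (simp add: dist_norm)
  have "c-lipschitz_on UNIV (spec_norm :: real^'n^'m \<Rightarrow> real)"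
  proof (rule lipschitz_onI)
    show "dist (spec_norm X) (spec_norm Y) \<le> c * dist X Y" for X Y :: "real^'n^'m"
      using diff[of X Y] diff[of Y X] by (simp add: dist_real_def dist_commute abs_le_iff)
  qed (simp add: c_def)
  then show ?thesis by (rule lipschitz_on_continuous_on)
qed

lemma borel_measurable_spec_norm:
  fixes X :: "'a \<Rightarrow> real^'n^'m"
  assumes "\<And>i j. (\<lambda>\<omega>. X \<omega> $ i $ j) \<in> borel_measurable M"
  shows "(\<lambda>\<omega>. spec_norm (X \<omega>)) \<in> borel_measurable M"
proof (rule borel_measurable_continuous_on[OF continuous_on_spec_norm])
  have "(\<lambda>\<omega>. \<Sum>i\<in>UNIV. \<Sum>j\<in>UNIV. X \<omega> $ i $ j *\<^sub>R axis i (axis j (1::real))) \<in> borel_measurable M"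
    by (intro borel_measurable_sum borel_measurable_scaleR borel_measurable_const assms)
  then show "X \<in> borel_measurable M"
    by (simp only: matrix_unit_expansion[symmetric])
qed

section \<open>The residual as a moving average of the noises\<close>

text \<open>The gains with which the noises \<open>l\<close> steps back enter the residual. They are the blocks
  \<open>C Dbar\<^sub>n\<^sub>,\<^sub>k\<close> and \<open>C Lbar\<^sub>n\<^sub>,\<^sub>k\<close> with \<open>n - k = l\<close>, which depend on \<open>l\<close> only; at lag \<open>0\<close> only the
  measurement noise enters, with gain \<open>-1\<close>.\<close>
definition gain_w :: "real^'p^'p \<Rightarrow> real^'m^'p \<Rightarrow> real^'p^'m \<Rightarrow> nat \<Rightarrow> real^'p^'m" where
  "gain_w A L C l = (if l = 0 then 0 else C ** Dbar A L C l 0)"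

definition gain_z :: "real^'p^'p \<Rightarrow> real^'m^'p \<Rightarrow> real^'p^'m \<Rightarrow> nat \<Rightarrow> real^'m^'m" where
  "gain_z A L C l = (if l = 0 then - mat 1 else C ** Lbar A L C l 0)"

lemma Dbar_lag: "n - Suc k = l \<Longrightarrow> Dbar A L C n k = Dbar A L C (Suc l) 0"
  by (simp add: Dbar_def)

lemma Lbar_lag: "n - Suc k = l \<Longrightarrow> Lbar A L C n k = Lbar A L C (Suc l) 0"
  by (simp add: Lbar_def)

lemma uminus_matrix_vector_mult: "(- X) *v x = - (X *v (x::real^'n))"
  by (simp add: vec_eq_iff matrix_vector_mult_def sum_negf)

lemma matrix_mult_uminus: "X ** (- Y) = - (X ** (Y::real^'n^'m))"
  by (simp add: vec_eq_iff matrix_matrix_mult_def sum_negf)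

lemma matrix_mult_add_left: "(X + Y) ** Z = X ** Z + Y ** (Z::real^'n^'m)"
  by (simp add: vec_eq_iff matrix_matrix_mult_def distrib_right sum.distrib)

lemma matrix_vector_mult_sum: "X *v (\<Sum>i\<in>I. f i) = (\<Sum>i\<in>I. X *v (f i :: real^'n))"
  by (rule linear_sum[OF matrix_vector_mul_linear])

lemma error_moving_average:
  fixes A :: "real^'p^'p" and C :: "real^'p^'m"
  assumes "\<delta> 0 = 0" "\<And>n. \<delta> (Suc n) = (A + L ** C) *v \<delta> n - w n - L *v \<zeta> n"
  shows "\<delta> n = (\<Sum>l<n. Dbar A L C (Suc l) 0 *v w (n - Suc l) + Lbar A L C (Suc l) 0 *v \<zeta> (n - Suc l))"
proof (induction n)
  case 0
  then show ?case by (simp add: assms(1))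
next
  case (Suc n)
  have D: "Dbar A L C (Suc (Suc l)) 0 = (A + L ** C) ** Dbar A L C (Suc l) 0" for l
    by (simp add: Dbar_def matrix_mult_uminus)
  have E: "Lbar A L C (Suc (Suc l)) 0 = (A + L ** C) ** Lbar A L C (Suc l) 0" for l
    by (simp add: Lbar_def matrix_mult_uminus matrix_mul_assoc)
  have "Dbar A L C (Suc 0) 0 = - mat 1" "Lbar A L C (Suc 0) 0 = - L"
    by (simp_all add: Dbar_def Lbar_def)
  then show ?case
    unfolding assms(2) sum.lessThan_Suc_shift D E Suc
    by (simp add: matrix_vector_mult_sum matrix_vector_right_distrib matrix_vector_mul_assoc
        uminus_matrix_vector_mult)
qed

lemma residual_moving_average:
  fixes A :: "real^'p^'p" and C :: "real^'p^'m"
  assumes "\<delta> 0 = 0" "\<And>n. \<delta> (Suc n) = (A + L ** C) *v \<delta> n - w n - L *v \<zeta> n"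
  shows "C *v \<delta> n - \<zeta> n = (\<Sum>l\<le>n. gain_w A L C l *v w (n - l) + gain_z A L C l *v \<zeta> (n - l))"
proof -
  have "C *v \<delta> n = (\<Sum>l<n. gain_w A L C (Suc l) *v w (n - Suc l) + gain_z A L C (Suc l) *v \<zeta> (n - Suc l))"
    unfolding error_moving_average[where \<delta> = \<delta> and w = w and \<zeta> = \<zeta>, OF assms]
    by (simp add: matrix_vector_mult_sum matrix_vector_right_distrib matrix_vector_mul_assoc gain_w_def gain_z_def)
  then show ?thesis
    unfolding sum.atMost_shift by (simp add: gain_w_def gain_z_def uminus_matrix_vector_mult)
qed

text \<open>In this form the centring matrix is the second moment of the residual, by
  \<open>expectation_filter_product\<close>.\<close>
lemma Rmat_eq_gains:
  fixes A :: "real^'p^'p" and C :: "real^'p^'m"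
  shows "Rmat A L C \<Sigma>w \<Sigma>z n = (\<Sum>l\<le>n. gain_w A L C l ** \<Sigma>w ** transpose (gain_w A L C l)
    + gain_z A L C l ** \<Sigma>z ** transpose (gain_z A L C l))"
proof -
  define g where "g l = gain_w A L C l ** \<Sigma>w ** transpose (gain_w A L C l)
    + gain_z A L C l ** \<Sigma>z ** transpose (gain_z A L C l)" for l
  define f where "f X = C ** X ** transpose C" for X
  have g_0: "g 0 = \<Sigma>z"
  proof -
    have "transpose (- mat 1 :: real^'m^'m) = - mat 1"
      by (simp add: vec_eq_iff transpose_def mat_def)
    moreover have "(- mat 1) ** \<Sigma>z = - \<Sigma>z"
    proof -
      have "(- X) ** Y = - (X ** Y)" for X Y :: "real^'m^'m"
        by (simp add: vec_eq_iff matrix_matrix_mult_def sum_negf)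
      then show ?thesis by simp
    qed
    moreover have "(- \<Sigma>z) ** (- mat 1) = \<Sigma>z"
      by (simp add: matrix_mult_uminus)
    moreover have "(0 :: real^'p^'m) ** \<Sigma>w ** transpose (0 :: real^'p^'m) = 0"
      by (simp add: vec_eq_iff matrix_matrix_mult_def)
    ultimately show ?thesis by (simp add: g_def gain_w_def gain_z_def)
  qed
  have "Modules.additive f"
    unfolding Modules.additive_def f_def by (simp add: matrix_add_ldistrib matrix_mult_add_left)
  moreover have "f (Dbar A L C n k ** \<Sigma>w ** transpose (Dbar A L C n k)
      + Lbar A L C n k ** \<Sigma>z ** transpose (Lbar A L C n k)) = g (Suc (n - Suc k))" for k
    unfolding f_def g_def gain_w_def gain_z_def Dbar_lag[where n = n and k = k, OF refl] Lbar_lag[where n = n and k = k, OF refl]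
    by (simp add: matrix_add_ldistrib matrix_mult_add_left matrix_transpose_mul matrix_mul_assoc)
  ultimately have "Rmat A L C \<Sigma>w \<Sigma>z n = (\<Sum>k<n. g (Suc (n - Suc k))) + \<Sigma>z"
    unfolding Rmat_def f_def[symmetric] by (simp add: Modules.additive.sum)
  also have "(\<Sum>k<n. g (Suc (n - Suc k))) = (\<Sum>k<n. g (Suc k))"
    by (rule sum.nat_diff_reindex)
  also have "(\<Sum>k<n. g (Suc k)) + \<Sigma>z = (\<Sum>l\<le>n. g l)"
    by (simp add: sum.atMost_shift add.commute g_0)
  finally show ?thesis by (simp add: g_def)
qed

lemma Kbar_eq_gains:
  "Kbar A L C Kw Kz n
    = Kz + (\<Sum>l<n. spec_norm (gain_w A L C (Suc l)) * Kw + spec_norm (gain_z A L C (Suc l)) * Kz)"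
proof -
  have "Kbar A L C Kw Kz n
      = Kz + (\<Sum>k<n. spec_norm (gain_w A L C (Suc (n - Suc k))) * Kw + spec_norm (gain_z A L C (Suc (n - Suc k))) * Kz)"
    unfolding Kbar_def
  proof (intro arg_cong2[where f = "(+)"] sum.cong refl)
    fix k
    have D: "Dbar A L C n k = Dbar A L C (Suc (n - Suc k)) 0" "Lbar A L C n k = Lbar A L C (Suc (n - Suc k)) 0"
      by (simp_all only: Dbar_lag[where n = n and k = k, OF refl] Lbar_lag[where n = n and k = k, OF refl])
    show "spec_norm (C ** Dbar A L C n k) * Kw = spec_norm (gain_w A L C (Suc (n - Suc k))) * Kw"
      "spec_norm (C ** Lbar A L C n k) * Kz = spec_norm (gain_z A L C (Suc (n - Suc k))) * Kz"
      by (simp_all only: gain_w_def gain_z_def D if_False nat.distinct)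
  qed
  then show ?thesis
    by (simp only: sum.nat_diff_reindex[of "\<lambda>l. spec_norm (gain_w A L C (Suc l)) * Kw + spec_norm (gain_z A L C (Suc l)) * Kz"])
qed

lemma gain_le_Kbar:
  assumes "0 \<le> Kz"
  shows "(\<Sum>l\<le>n. spec_norm (gain_w A L C l) * Kw + spec_norm (gain_z A L C l) * Kz) \<le> Kbar A L C Kw Kz n"
proof -
  have "spec_norm (gain_w A L C 0) = 0"
    by (simp add: gain_w_def spec_norm_def onorm_zero)
  moreover have "spec_norm (gain_z A L C 0) \<le> 1"
    unfolding spec_norm_def by (rule onorm_le) (simp add: gain_z_def uminus_matrix_vector_mult)
  ultimately have "spec_norm (gain_w A L C 0) * Kw + spec_norm (gain_z A L C 0) * Kz \<le> Kz"
    using mult_right_mono[OF _ assms, of "spec_norm (gain_z A L C 0)" 1] by simp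
  then show ?thesis
    unfolding Kbar_eq_gains sum.atMost_shift by simp
qed

lemma Kbar_mono:
  assumes "0 \<le> Kw" "0 \<le> Kz" "n \<le> N"
  shows "Kbar A L C Kw Kz n \<le> Kbar A L C Kw Kz N"
  unfolding Kbar_eq_gains using assms
  by (intro add_left_mono sum_mono2 add_nonneg_nonneg mult_nonneg_nonneg spec_norm_nonneg) simp_all

lemma Kbar_nonneg: "0 \<le> Kw \<Longrightarrow> 0 \<le> Kz \<Longrightarrow> 0 \<le> Kbar A L C Kw Kz n"
  unfolding Kbar_eq_gains by (intro add_nonneg_nonneg sum_nonneg mult_nonneg_nonneg spec_norm_nonneg)

text \<open>The hypothesis bounds only averages of \<open>Kbar\<^sup>4\<close>. Since \<open>Kbar\<close> is nondecreasing, the average over the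
  second half of \<open>{..<2(n + 1)}\<close> dominates its value at \<open>n\<close>. A bound on \<open>Kbar\<close> is the absolute summability
  of the filter gains.\<close>
lemma Kbar_bounded:
  assumes K: "0 \<le> Kw" "0 \<le> Kz" and c1: "\<And>N. 1 \<le> N \<Longrightarrow> c1 (Kbar A L C Kw Kz) N \<le> real N * S"
  shows "Kbar A L C Kw Kz n \<le> 1 + S"
proof -
  define b where "b = Kbar A L C Kw Kz"
  define N where "N = 2 * Suc n"
  have b0: "0 \<le> b k" for k
    unfolding b_def by (rule Kbar_nonneg[OF K])
  have "real (Suc n) * b n ^ 4 \<le> (\<Sum>k=n..<N. b n ^ 4)"
    using b0[of n] by (simp add: N_def mult_right_mono)
  also have "\<dots> \<le> (\<Sum>k=n..<N. b k ^ 4)"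
    using b0 by (intro sum_mono power_mono) (auto simp: b_def intro: Kbar_mono[OF K])
  also have "\<dots> \<le> (\<Sum>k<N. b k ^ 4)"
    by (intro sum_mono2) auto
  finally have "8 * (real (Suc n) * b n ^ 4) \<le> c1 b N"
    by (simp add: c1_def)
  also have "c1 b N \<le> real N * S"
    unfolding b_def by (rule c1) (simp add: N_def)
  also have "\<dots> = real (Suc n) * (2 * S)"
    by (simp add: N_def)
  finally have "real (Suc n) * (8 * b n ^ 4) \<le> real (Suc n) * (2 * S)"
    by (simp only: mult_ac)
  then have "8 * b n ^ 4 \<le> 2 * S"
    by (simp only: mult_le_cancel_left_pos of_nat_0_less_iff zero_less_Suc)
  moreover have "b n \<le> 1 + b n ^ 4"
  proof (cases "b n \<le> 1")
    case True
    then show ?thesis using b0[of n] zero_le_power[of "b n" 4] by linarith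
  next
    case False
    then show ?thesis using power_increasing[of 1 4 "b n"] by simp
  qed
  moreover have "0 \<le> b n ^ 4" by simp
  ultimately show ?thesis unfolding b_def by linarith
qed

section \<open>The tests\<close>

text \<open>Both tests average the output of one moving average filter: against itself, centred by \<open>Rmat\<close>,
  and against the delayed watermark.\<close>
lemma (in noise) tests_eventually_below_threshold:
  fixes A :: "real^'p^'p" and C :: "real^'p^'m" and L :: "real^'m^'p" and s :: "nat \<Rightarrow> int"
  assumes \<delta>_0: "\<forall>\<omega>\<in>space M. \<delta> 0 \<omega> = 0"
    and \<delta>_Suc: "\<forall>\<omega>\<in>space M. \<forall>n. \<delta> (Suc n) \<omega> = (A + L ** C) *v \<delta> n \<omega> - w n \<omega> - L *v \<zeta> n \<omega>"
    and d: "\<forall>\<omega>\<in>space M. \<forall>n. d n \<omega> = C *v \<delta> n \<omega> - \<zeta> n \<omega>"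
    and I: "{- int k' - 1..} \<subseteq> I"
    and pos: "0 < S" "0 < \<rho>"
    and c1: "\<forall>N\<ge>1. c1 (Kbar A L C Kw Kz) N \<le> real N * S"
  defines "R \<equiv> Rmat A L C \<Sigma>w \<Sigma>z"
  shows "(\<lambda>\<omega>. spec_norm (Phi1 (\<lambda>n. d n \<omega>) R N)) \<in> borel_measurable M" (is ?meas1)
    and "(\<lambda>\<omega>. spec_norm (Phi2 (\<lambda>n. d n \<omega>) (\<lambda>j. e j \<omega>) k' N)) \<in> borel_measurable M" (is ?meas2)
    and "AE \<omega> in M. \<forall>\<^sub>F N in sequentially. spec_norm (Phi1 (\<lambda>n. d n \<omega>) R N) < threshold \<rho> S N" (is ?ae1)
    and "AE \<omega> in M. \<forall>\<^sub>F N in sequentially.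
           spec_norm (Phi2 (\<lambda>n. d n \<omega>) (\<lambda>j. e j \<omega>) k' N) < threshold \<rho> S N" (is ?ae2)
proof -
  define G where "G = gain_w A L C"
  define H where "H = gain_z A L C"
  have K: "0 \<le> Kw" "0 \<le> Kz"
    using bound_nonneg[OF w_bound] bound_nonneg[OF z_bound] .
  have d_eq: "d n \<omega> = (\<Sum>l\<le>n. response (G l) (H l) (n - l) \<omega>)" if "\<omega> \<in> space M" for n \<omega>
  proof -
    have "d n \<omega> = C *v \<delta> n \<omega> - \<zeta> n \<omega>"
      using d that by blast
    then show ?thesis
      unfolding response_def G_def H_def using \<delta>_0 \<delta>_Suc that
      by (subst residual_moving_average[symmetric, where \<delta> = "\<lambda>n. \<delta> n \<omega>" and w = "\<lambda>n. w n \<omega>"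
            and \<zeta> = "\<lambda>n. \<zeta> n \<omega>"]) blast+
  qed
  have gain: "(\<Sum>l\<le>n. spec_norm (G l) * Kw + spec_norm (H l) * Kz) \<le> 1 + S" for n
    unfolding G_def H_def using gain_le_Kbar[OF K(2)] Kbar_bounded[OF K c1[rule_format]] by (rule order_trans)
  note filter = d_eq gain
  define X1 where "X1 n \<omega> = outer (d n \<omega>) (d n \<omega>) - R n" for n \<omega>
  define s where "s n = int n - int k' - 1" for n
  define X2 where "X2 n \<omega> = outer (d n \<omega>) (e (s n) \<omega>)" for n \<omega>
  have s: "range s \<subseteq> I" "inj s"
    using I by (auto simp: s_def inj_def)
  have R: "R n $ i $ j = expectation (\<lambda>\<omega>. d n \<omega> $ i * d n \<omega> $ j)" for n i j
    by (subst expectation_filter_product[OF filter]) (simp_all only: R_def G_def H_def Rmat_eq_gains)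
  have X1_nth: "X1 n \<omega> $ i $ j = d n \<omega> $ i * d n \<omega> $ j - expectation (\<lambda>\<omega>. d n \<omega> $ i * d n \<omega> $ j)" for n \<omega> i j
    by (simp add: X1_def outer_def R)
  have X2_nth: "X2 n \<omega> $ i $ j = d n \<omega> $ i * e (s n) \<omega> $ j" for n \<omega> i j
    by (simp add: X2_def outer_def)
  have d_bdd: "bounded_rv (\<lambda>\<omega>. d n \<omega> $ i)" for n i
    by (rule bounded_filter[OF filter])
  have e_bdd: "bounded_rv (\<lambda>\<omega>. e (s n) \<omega> $ i)" for n i
    using s(1) by (intro bounded_rv_vec_nth[OF e_rv e_bound]) auto
  have X1_bdd: "bounded_rv (\<lambda>\<omega>. X1 n \<omega> $ i $ j)" for n i j
    unfolding X1_nth by (intro bounded_rv_diff bounded_rv_mult bounded_rv_const d_bdd)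
  have X2_bdd: "bounded_rv (\<lambda>\<omega>. X2 n \<omega> $ i $ j)" for n i j
    unfolding X2_nth by (intro bounded_rv_mult d_bdd e_bdd)
  have Phi1: "Phi1 (\<lambda>n. d n \<omega>) R N = (1 / real N) *\<^sub>R (\<Sum>n<N. X1 n \<omega>)" for N \<omega>
    by (simp add: Phi1_def X1_def)
  have Phi2: "Phi2 (\<lambda>n. d n \<omega>) (\<lambda>j. e j \<omega>) k' N = (1 / real N) *\<^sub>R (\<Sum>n<N. X2 n \<omega>)" for N \<omega>
    by (simp add: Phi2_def X2_def s_def)
  show ?meas1
    unfolding Phi1 using bounded_rv_measurable[OF X1_bdd] by (intro borel_measurable_spec_norm) simp
  show ?meas2
    unfolding Phi2 using bounded_rv_measurable[OF X2_bdd] by (intro borel_measurable_spec_norm) simp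
  show ?ae1
    unfolding Phi1
  proof (rule spec_norm_average_below_threshold[OF X1_bdd _ pos])
    show "expectation (\<lambda>\<omega>. (\<Sum>m=a..<a + n. X1 m \<omega> $ i $ j) ^ 4) \<le> 64 * (1 + S + 2) ^ 8 * (real n)\<^sup>2" for i j a n
      unfolding X1_nth by (rule fourth_moment_filter_covariance[OF filter])
  qed
  show ?ae2
    unfolding Phi2
  proof (rule spec_norm_average_below_threshold[OF X2_bdd _ pos])
    show "expectation (\<lambda>\<omega>. (\<Sum>m=a..<a + n. X2 m \<omega> $ i $ j) ^ 4) \<le> 4 * ((1 + S) * Ke) ^ 4 * (real n)\<^sup>2" for i j a n
      unfolding X2_nth by (rule fourth_moment_filter_watermark[OF filter s])
  qed
qed

theorem theorem5:
  fixes M :: "'a measure"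
    and A :: "real^'p^'p" and B :: "real^'q^'p"
    and C1 C2 :: "real^'p^'m"
    and K :: "real^'p^'q" and L1 L2 :: "real^'m^'p"
    and \<Sigma>w :: "real^'p^'p" and \<Sigma>\<zeta> \<Sigma>\<eta> :: "real^'m^'m" and \<Sigma>e :: "real^'q^'q"
    and Kw Kz Ke S \<rho> :: real
    and P :: "real^('p + 'p)^('p + 'p)" and \<tau> k' :: nat
    and w :: "nat \<Rightarrow> 'a \<Rightarrow> real^'p" and \<zeta> \<eta> v :: "nat \<Rightarrow> 'a \<Rightarrow> real^'m"
    and e :: "int \<Rightarrow> 'a \<Rightarrow> real^'q" and \<alpha> :: "int \<Rightarrow> 'a \<Rightarrow> real"
    and x x' xh \<delta> :: "nat \<Rightarrow> 'a \<Rightarrow> real^'p" and u :: "nat \<Rightarrow> 'a \<Rightarrow> real^'q"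
    and y d :: "nat \<Rightarrow> 'a \<Rightarrow> real^'m"
    and R :: "nat \<Rightarrow> real^'m^'m" and t :: "nat \<Rightarrow> real" and I :: "int set"
    and E :: "nat \<Rightarrow> 'a set"
  assumes prob: "prob_space M"
    \<comment> \<open>noises\<close>
    and w_iid: "prob_space.iid M w UNIV"
    and w_mean: "\<forall>n. (\<integral>\<omega>. w n \<omega> \<partial>M) = 0"
    and w_cov: "\<forall>n. covariance_matrix M (w n) = \<Sigma>w"
    and zeta_iid: "prob_space.iid M \<zeta> UNIV"
    and zeta_mean: "\<forall>n. (\<integral>\<omega>. \<zeta> n \<omega> \<partial>M) = 0"
    and zeta_cov: "\<forall>n. covariance_matrix M (\<zeta> n) = \<Sigma>\<zeta>"
    and eta_iid: "prob_space.iid M \<eta> UNIV"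
    and eta_mean: "\<forall>n. (\<integral>\<omega>. \<eta> n \<omega> \<partial>M) = 0"
    and eta_cov: "\<forall>n. covariance_matrix M (\<eta> n) = \<Sigma>\<eta>"
    and cov_le: "loewner_le \<Sigma>\<zeta> \<Sigma>\<eta>"
    and w_indep: "prob_space.indep_processes M w UNIV (\<lambda>n \<omega>. (\<zeta> n \<omega>, \<eta> n \<omega>)) UNIV"
    and w_bound: "AE \<omega> in M. \<forall>n. norm (w n \<omega>) \<le> Kw"
    and z_bound: "AE \<omega> in M. \<forall>n. norm (\<zeta> n \<omega>) \<le> Kz \<and> norm (\<eta> n \<omega>) \<le> Kz"
    \<comment> \<open>gains\<close>
    and stab: "stabilizable A B"
    and detect: "detectable A C1" "detectable A C2"
    and K_stable: "schur_stable (A + B ** K)"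
    and L_stable: "schur_stable (A + L1 ** C1)" "schur_stable (A + L2 ** C2)"
    \<comment> \<open>dwell time and lag of the watermark\<close>
    and P_lyap: "block_matrix A B K C1 C2 L1 L2 1 ** P ** transpose (block_matrix A B K C1 C2 L1 L2 1)
                 - P = - mat 1"
    and dwell: "is_dwell_time (block_matrix A B K C1 C2 L1 L2 0) P \<tau>"
    and lag: "is_first_markov_index A B K C1 k'"
    \<comment> \<open>watermark\<close>
    and I_eq: "I = {- int k' - 1..}"
    and e_iid: "prob_space.iid M e I"
    and e_mean: "\<forall>j\<in>I. (\<integral>\<omega>. e j \<omega> \<partial>M) = 0"
    and e_cov: "\<forall>j\<in>I. covariance_matrix M (e j) = \<Sigma>e"
    and e_bound: "AE \<omega> in M. \<forall>j\<in>I. norm (e j \<omega>) \<le> Ke"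
    and e_indep: "prob_space.indep_processes M e I (\<lambda>n \<omega>. (w n \<omega>, \<zeta> n \<omega>, \<eta> n \<omega>)) UNIV"
    \<comment> \<open>closed-loop switched system with the first observer\<close>
    and plant: "\<forall>\<omega>\<in>space M. \<forall>n. x (Suc n) \<omega> = A *v x n \<omega> + B *v u n \<omega> + w n \<omega>"
    and measurement: "\<forall>\<omega>\<in>space M. \<forall>n. y n \<omega> =
            switch (\<alpha> (int n) \<omega>) C1 C2 *v x n \<omega> + switch (\<alpha> (int n) \<omega>) (\<zeta> n \<omega>) (\<eta> n \<omega>)
            + \<alpha> (int n) \<omega> *\<^sub>R v n \<omega>"
    and control: "\<forall>\<omega>\<in>space M. \<forall>n. u n \<omega> = K *v x' n \<omega> + e (int n) \<omega>"
    and observer1: "\<forall>\<omega>\<in>space M. \<forall>n. x' (Suc n) \<omega> =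
            (A + B ** K + switch (\<alpha> (int n) \<omega>) L1 L2 ** switch (\<alpha> (int n) \<omega>) C1 C2) *v x' n \<omega>
            + B *v e (int n) \<omega> - switch (\<alpha> (int n) \<omega>) L1 L2 *v y n \<omega>"
    and no_attack: "\<forall>\<omega>\<in>space M. \<forall>n. v n \<omega> = 0"
    \<comment> \<open>second observer, its error and its residual\<close>
    and delta_eq: "\<forall>\<omega>\<in>space M. \<forall>n. \<delta> n \<omega> = xh n \<omega> - x n \<omega>"
    and delta_0: "\<forall>\<omega>\<in>space M. \<delta> 0 \<omega> = 0"
    and delta_Suc: "\<forall>\<omega>\<in>space M. \<forall>n. \<delta> (Suc n) \<omega> = (A + L1 ** C1) *v \<delta> n \<omega> - w n \<omega> - L1 *v \<zeta> n \<omega>"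
    and d_eq: "\<forall>\<omega>\<in>space M. \<forall>n. d n \<omega> = C1 *v xh n \<omega> - (C1 *v x n \<omega> + \<zeta> n \<omega>)"
    \<comment> \<open>tests and threshold\<close>
    and R_eq: "R = Rmat A L1 C1 \<Sigma>w \<Sigma>\<zeta>"
    and S_pos: "0 < S"
    and S_bound: "\<forall>N\<ge>1. max (max (c1 (Kbar A L1 C1 Kw Kz) N) (c2 (Kbar A L1 C1 Kw Kz) R Ke \<Sigma>e N))
                        (c3 M e Ke \<Sigma>e N) \<le> real N * S"
    and rho_pos: "0 < \<rho>"
    and t_eq: "t = threshold \<rho> S"
    \<comment> \<open>switching rule\<close>
    and alpha_01: "\<forall>\<omega>\<in>space M. \<forall>j. \<alpha> j \<omega> \<in> {0, 1}"
    and rule: "\<forall>\<omega>\<in>space M. switching_rule \<tau>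
            (\<lambda>N. spec_norm (Phi1 (\<lambda>n. d n \<omega>) R N) \<ge> t N
               \<or> spec_norm (Phi2 (\<lambda>n. d n \<omega>) (\<lambda>j. e j \<omega>) k' N) \<ge> t N)
            (\<lambda>j. \<alpha> j \<omega>)"
    and E_eq: "\<forall>N\<ge>1. E N =
            {\<omega> \<in> space M. spec_norm (Phi1 (\<lambda>n. d n \<omega>) R N) > t N}
            \<union> {\<omega> \<in> space M. spec_norm (Phi2 (\<lambda>n. d n \<omega>) (\<lambda>j. e j \<omega>) k' N) > t N}"
  shows "limsup E \<in> sets M \<and> measure M (limsup E) = 0
       \<and> (AE \<omega> in M. finite {N. 1 \<le> N \<and> \<alpha> (int N - 1) \<omega> = 1 \<and> \<alpha> (int N) \<omega> = 0})"
proof -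
  interpret prob_space M by (rule prob)
  interpret src: independent_sources M
      "case_sum (case_sum (preimages M w) (preimages M \<zeta>)) (preimages M e)" "(UNIV <+> UNIV) <+> I"
    using w_iid zeta_iid e_iid w_indep e_indep by (rule independent_sources_noises)
  interpret noise M w \<zeta> e I Kw Kz Ke \<Sigma>w \<Sigma>\<zeta>
  proof
    show "AE \<omega> in M. norm (w k \<omega>) \<le> Kw" for k
      using w_bound by eventually_elim simp
    show "AE \<omega> in M. norm (\<zeta> k \<omega>) \<le> Kz" for k
      using z_bound by eventually_elim simp
    show "AE \<omega> in M. norm (e k \<omega>) \<le> Ke" if "k \<in> I" for k
      using e_bound by eventually_elim (use that in simp)
  qed (use w_mean zeta_mean e_mean w_cov zeta_cov in simp_all)

  have d: "\<forall>\<omega>\<in>space M. \<forall>n. d n \<omega> = C1 *v \<delta> n \<omega> - \<zeta> n \<omega>"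
    using d_eq delta_eq by (simp add: matrix_vector_mult_diff_distrib)
  have c1: "\<forall>N\<ge>1. c1 (Kbar A L1 C1 Kw Kz) N \<le> real N * S"
    using S_bound by simp
  have I: "{- int k' - 1..} \<subseteq> I"
    by (simp add: I_eq)
  note tests = tests_eventually_below_threshold[OF delta_0 delta_Suc d I S_pos rho_pos c1, folded R_eq t_eq]

  have below: "AE \<omega> in M. \<forall>\<^sub>F N in sequentially.
      spec_norm (Phi1 (\<lambda>n. d n \<omega>) R N) < t N \<and> spec_norm (Phi2 (\<lambda>n. d n \<omega>) (\<lambda>j. e j \<omega>) k' N) < t N"
    using tests(3,4) by eventually_elim (rule eventually_conj)

  have E_sets: "E N \<in> sets M" if "1 \<le> N" for N
    using E_eq that tests(1,2)[of N] by simp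
  \<comment> \<open>\<open>E 0\<close> is an arbitrary set, so the union has to start at index \<open>1\<close>\<close>
  have limsup_eq: "limsup E = (\<Inter>n. \<Union>m\<in>{n..}. E (Suc m))"
  proof -
    have "(\<forall>n. \<exists>m\<ge>n. \<omega> \<in> E m) \<longleftrightarrow> (\<forall>n. \<exists>m\<ge>n. \<omega> \<in> E (Suc m))" for \<omega>
      by (metis Suc_le_D Suc_le_mono le_SucI)
    then show ?thesis
      unfolding limsup_INF_SUP by (auto simp: set_eq_iff Bex_def)
  qed
  have limsup_sets: "limsup E \<in> sets M"
    unfolding limsup_eq using E_sets by (intro sets.countable_INT image_subsetI sets.countable_UN) auto
  have "AE \<omega> in M. \<omega> \<notin> limsup E"
    using below
  proof eventually_elim
    case (elim \<omega>)
    then obtain N0 where N0: "\<And>N. N0 \<le> N \<Longrightarrow> spec_norm (Phi1 (\<lambda>n. d n \<omega>) R N) < t N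
        \<and> spec_norm (Phi2 (\<lambda>n. d n \<omega>) (\<lambda>j. e j \<omega>) k' N) < t N"
      by (auto simp: eventually_sequentially)
    have "\<omega> \<notin> E (Suc m)" if "N0 \<le> m" for m
      using N0[of "Suc m"] that E_eq by simp
    then show ?case unfolding limsup_eq by auto
  qed
  then have "prob (limsup E) = 0"
    using limsup_sets by (simp add: prob_eq_0)
  moreover have "AE \<omega> in M. finite {N. 1 \<le> N \<and> \<alpha> (int N - 1) \<omega> = 1 \<and> \<alpha> (int N) \<omega> = 0}"
    using below AE_space
  proof eventually_elim
    case (elim \<omega>)
    then obtain N0 where N0: "\<And>N. N0 \<le> N \<Longrightarrow> spec_norm (Phi1 (\<lambda>n. d n \<omega>) R N) < t N
        \<and> spec_norm (Phi2 (\<lambda>n. d n \<omega>) (\<lambda>j. e j \<omega>) k' N) < t N"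
      by (auto simp: eventually_sequentially)
    have "N < N0" if N: "1 \<le> N" "\<alpha> (int N - 1) \<omega> = 1" "\<alpha> (int N) \<omega> = 0" for N
    proof (rule ccontr)
      \<comment> \<open>below the threshold the rule leaves a signal that is at \<open>1\<close> unchanged\<close>
      assume "\<not> N < N0"
      then have "\<alpha> (int N) \<omega> = \<alpha> (int N - 1) \<omega>"
        using N0[of N] rule elim(2) N by (simp add: switching_rule_def not_le[symmetric] del: not_le)
      then show False using N by simp
    qed
    then have "{N. 1 \<le> N \<and> \<alpha> (int N - 1) \<omega> = 1 \<and> \<alpha> (int N) \<omega> = 0} \<subseteq> {..<N0}"
      by blast
    then show ?case by (rule finite_subset) simp
  qed
  ultimately show ?thesis using limsup_sets by simp
qed

end
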